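(* Let $d\ge 1$, let $K_d=\prod_{j=1}^d[a_j,b_j]\subset\mathbb{R}^d$ be a compact $d$-dimensional interval and let $x_0\in K_d$. Let $(g_n)_{n\ge1}$ and $(W_n)_{n\ge1}$ be independent sequences such that: $(g_n)_{n\ge1}$ is a sequence of independent symmetric complex-valued sub-Gaussian random variables with parameter $1$; $(W_n)_{n\ge1}$ is a sequence of complex-valued continuous random fields on $K_d$ such that for every $x\in K_d$, almost surely $\sum_{n=1}^{+\infty}|W_n(x)|^2<+\infty$. Put $S_N(x)=\sum_{n=1}^N W_n(x)g_n$, $S(x)=\sum_{n=1}^{+\infty}W_n(x)g_n$, $R_N(x)=S(x)-S_N(x)$ and $$r_N(x,y)=\Big(\sum_{n=N+1}^{+\infty}|W_n(x)-W_n(y)|^2\Big)^{1/2},\qquad N\in\mathbb{N},\ x,y\in K_d.$$ Let $\rho$ be a quasi-metric on $\mathbb{R}^d$ for which there exist $0<\underline{H}\le\overline{H}\le1$ and $c_{2,1},c_{2,2}\in(0,\infty)$ with $c_{2,1}\|x-y\|^{\overline{H}}\le\rho(x,y)\le c_{2,2}\|x-y\|^{\underline{H}}$ for all $x,y\in\mathbb{R}^d$ with $\|x-y\|\le1$. Assume that there exist an almost sure event $\Omega'$, random variables $\gamma>0$, $\beta\in(0,1]$, $\eta\in\mathbb{R}$ and a positive random sequence $(b(N))_{N\in\mathbb{N}}$ such that on $\Omega'$ $$\forall N\in\mathbb{N},\ \forall x,y\in B(x_0,\gamma)\cap K_d,\qquad r_N(x,y)\le b(N)\rho(x,y)^{\beta}|\log\rho(x,y)|^{\eta}.$$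 1. Then, almost surely, there exist $\gamma^*\in(0,\gamma)$ and $C\in(0,+\infty)$ such that $$|R_N(x)-R_N(y)|\le C\,b(N)\sqrt{\log(N+2)}\,\rho(x,y)^{\beta}|\log\rho(x,y)|^{\eta+1/2}$$ for all $N\in\mathbb{N}$ and all $x,y\in B(x_0,\gamma^* )\cap K_d$. 2. Moreover, if almost surely, for all $N\in\mathbb{N}$, $|R_N(x_0)|\le b(N)\sqrt{\log(N+2)}$, then, almost surely, there exist $\gamma^*\in(0,\gamma)$ and $C\in(0,+\infty)$ such that $$|R_N(x)|\le C\,b(N)\sqrt{\log(N+2)}$$ for all $N\in\mathbb{N}$ and all $x\in B(x_0,\gamma^* )\cap K_d$.
   Context: $\|\cdot\|$ is the Euclidean norm and $B(x_0,\gamma)=\{z:\|z-x_0\|\le\gamma\}$. $\mathbb{N}$ contains $0$ and $\sum_{n=1}^0=0$. A complex-valued random variable $Z$ is sub-Gaussian with parameter $s\in[0,+\infty)$ if $\mathbb{E}(e^{\Re(\overline z Z)})\le e^{s^2|z|^2/2}$ for all $z\in\mathbb{C}$. $Z$ is symmetric if $Z$ and $-Z$ have the same law. Under the hypotheses, for each fixed $x$ the series defining $S(x)$ converges almost surely; $S(x)$ denotes the limit of $S_N(x)$ wherever it exists (and, say, $0$ elsewhere). A quasi-metric on $\mathbb{R}^d$ is a continuous function $\rho:\mathbb{R}^d\times\mathbb{R}^d\to[0,+\infty)$ such that $\rho(x,y)=0$ iff $x=y$, $\rho(x,y)=\rho(y,x)$, and for some constant $\kappa\ge1$, $\rho(x,z)\le\kappa(\rho(x,y)+\rho(y,z))$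 for all $x,y,z$. By convention $h^\beta|\log h|^\eta=0$ at $h=0$. The event $\Omega'$, $\rho$, and the random variables $\gamma,\beta,\eta,b(N)$ may depend on $x_0$. *)

theory Defs
  imports "HOL-Probability.Probability"
begin

context prob_space
begin

text \<open>
  The library's \<^emph>\<open>indep_var\<close> forces both variables to have the same value type; this is its
  heterogeneous version, by independence of the generated sigma-algebras.
\<close>

definition indep_pair ::
  "'b measure \<Rightarrow> ('a \<Rightarrow> 'b) \<Rightarrow> 'c measure \<Rightarrow> ('a \<Rightarrow> 'c) \<Rightarrow> bool" where
  "indep_pair N X N' Y \<longleftrightarrow>
     X \<in> M \<rightarrow>\<^sub>M N \<and> Y \<in> M \<rightarrow>\<^sub>M N' \<and>
     indep_set (sets (vimage_algebra (space M) X N)) (sets (vimage_algebra (space M) Y N'))"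

text \<open>The expectation is a Lebesgue integral in the extended half-line, so that the bound includes
  finiteness of the exponential moment.\<close>

definition sub_gaussian :: "real \<Rightarrow> ('a \<Rightarrow> complex) \<Rightarrow> bool" where
  "sub_gaussian s Z \<longleftrightarrow> 0 \<le> s \<and> random_variable borel Z \<and>
     (\<forall>z. (\<integral>\<^sup>+ \<omega>. ennreal (exp (Re (cnj z * Z \<omega>))) \<partial>M) \<le> ennreal (exp (s\<^sup>2 * (cmod z)\<^sup>2 / 2)))"

definition symmetric_rv :: "('a \<Rightarrow> complex) \<Rightarrow> bool" where
  "symmetric_rv Z \<longleftrightarrow> random_variable borel Z \<and> distr M borel Z = distr M borel (\<lambda>\<omega>. - Z \<omega>)"

text \<open>Only almost every sample path is required to be continuous.\<close>

definition continuous_random_field :: "'b::topological_space set \<Rightarrow> ('b \<Rightarrow> 'a \<Rightarrow> complex) \<Rightarrow> bool" where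
  "continuous_random_field K V \<longleftrightarrow>
     (\<forall>x\<in>K. random_variable borel (V x)) \<and> (AE \<omega> in M. continuous_on K (\<lambda>x. V x \<omega>))"

end

definition quasi_metric :: "('b::topological_space \<Rightarrow> 'b \<Rightarrow> real) \<Rightarrow> bool" where
  "quasi_metric \<rho> \<longleftrightarrow>
     continuous_on UNIV (\<lambda>(x, y). \<rho> x y) \<and>
     (\<forall>x y. 0 \<le> \<rho> x y) \<and>
     (\<forall>x y. \<rho> x y = 0 \<longleftrightarrow> x = y) \<and>
     (\<forall>x y. \<rho> x y = \<rho> y x) \<and>
     (\<exists>\<kappa>\<ge>1. \<forall>x y z. \<rho> x z \<le> \<kappa> * (\<rho> x y + \<rho> y z))"

text \<open>
  In the following, sequences are indexed from 1; the terms with index 0 are not used.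
  The function \<^term>\<open>S_lim\<close> is the pointwise limit of the partial sums, and 0 where it does not exist.
\<close>

definition S_part ::
  "(nat \<Rightarrow> 'b \<Rightarrow> 'a \<Rightarrow> complex) \<Rightarrow> (nat \<Rightarrow> 'a \<Rightarrow> complex) \<Rightarrow> nat \<Rightarrow> 'b \<Rightarrow> 'a \<Rightarrow> complex" where
  "S_part W g N x \<omega> = (\<Sum>n=1..N. W n x \<omega> * g n \<omega>)"

definition S_lim ::
  "(nat \<Rightarrow> 'b \<Rightarrow> 'a \<Rightarrow> complex) \<Rightarrow> (nat \<Rightarrow> 'a \<Rightarrow> complex) \<Rightarrow> 'b \<Rightarrow> 'a \<Rightarrow> complex" where
  "S_lim W g x \<omega> =
     (if convergent (\<lambda>N. S_part W g N x \<omega>) then lim (\<lambda>N. S_part W g N x \<omega>) else 0)"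

definition R_rem ::
  "(nat \<Rightarrow> 'b \<Rightarrow> 'a \<Rightarrow> complex) \<Rightarrow> (nat \<Rightarrow> 'a \<Rightarrow> complex) \<Rightarrow> nat \<Rightarrow> 'b \<Rightarrow> 'a \<Rightarrow> complex" where
  "R_rem W g N x \<omega> = S_lim W g x \<omega> - S_part W g N x \<omega>"

text \<open>Extended-real valued: the value is infinite when the series diverges.\<close>

definition r_rem ::
  "(nat \<Rightarrow> 'b \<Rightarrow> 'a \<Rightarrow> complex) \<Rightarrow> nat \<Rightarrow> 'b \<Rightarrow> 'b \<Rightarrow> 'a \<Rightarrow> ereal" where
  "r_rem W N x y \<omega> =
     (if summable (\<lambda>k. (cmod (W (N + 1 + k) x \<omega> - W (N + 1 + k) y \<omega>))\<^sup>2)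
      then ereal (sqrt (\<Sum>k. (cmod (W (N + 1 + k) x \<omega> - W (N + 1 + k) y \<omega>))\<^sup>2))
      else \<infinity>)"

text \<open>
  The modulus $h^\beta |\log h|^\eta$ for $h \ge 0$. It is 0 at $h = 0$ by convention. At $h = 1$
  the logarithm vanishes, where \<^term>\<open>0 powr \<eta> = 0\<close> for every real exponent; the case distinction
  restores $0^0 = 1$ and $0^\eta = \infty$ for $\eta < 0$.
\<close>

definition log_modulus :: "real \<Rightarrow> real \<Rightarrow> real \<Rightarrow> ereal" where
  "log_modulus \<beta> \<eta> h =
     (if h = 0 then 0
      else if h = 1 \<and> \<eta> = 0 then 1
      else if h = 1 \<and> \<eta> < 0 then \<infinity>
      else ereal (h powr \<beta> * \<bar>ln h\<bar> powr \<eta>))"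

end

theory Submission
  imports Defs "HOL-Real_Asymp.Real_Asymp"
begin

text \<open>
  Conditionally on the weights \<^term>\<open>W\<close>, the increment of a block sum
  \<open>\<Sum>l\<in>{N<..n}. W l x * g l\<close> between two points \<open>x\<close> and \<open>y\<close> is a sum of independent
  symmetric sub-Gaussian variables. Its maximum over all \<open>n\<close> has a Gaussian tail with variance of
  order \<open>r_N(x,y)\<^sup>2\<close> (lemma \<open>block_tail\<close>, by a maximal inequality for the exponentials
  of the partial sums).

  The box \<^term>\<open>K\<close> carries finite nets \<open>D j\<close> whose size is exponential in \<open>j\<close> and which are
  \<open>(1/2) ^ j\<close>-dense for the quasi-metric (lemma \<open>quasi_metric_net\<close>). A union bound shows that
  almost surely, with one random constant \<open>C\<close> and for all \<open>N\<close>, \<open>n\<close>, \<open>j\<close> and all pairs of points of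
  \<open>D j\<close> and \<open>D (j + 1)\<close>, the increment is at most
  \<open>C * sqrt (j + 1) * sqrt (ln (N + 2)) * r_N(x,y)\<close> (lemmas \<open>AE_uniform_block_bound\<close> and
  \<open>AE_random_weights\<close>). This event involves only the noise and the weights. The quantities
  \<open>\<gamma>\<close>, \<open>\<beta>\<close>, \<open>\<eta>\<close> and \<open>b(N)\<close>, which need not be independent of the noise, are used
  only afterwards, in a deterministic argument at a fixed sample point.

  There, \<open>r_N\<close> is replaced by the modulus that bounds it, and the increments are summed along
  chains through the nets (lemma \<open>chaining\<close>). At scale \<open>h = (1/2) ^ j\<close> the factor
  \<open>sqrt (j + 1)\<close> is of the order of \<open>\<bar>ln h\<bar> powr (1/2)\<close>, which explains the exponent
  \<open>\<eta> + 1/2\<close>. The bound is uniform in the endpoint \<open>n\<close> of the block. It therefore yields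
  equicontinuity of the partial sums, hence their convergence at every point near \<open>x0\<close>, and as
  \<open>n\<close> tends to infinity the bound for the remainders (lemma \<open>pathwise_remainder_modulus\<close>). The
  second claim follows by comparing \<open>x\<close> with \<open>x0\<close>, as the modulus is bounded near 0.
\<close>

section \<open>Exponential tails for block sums of a weighted series\<close>

context prob_space
begin

lemma nn_integral_indep_var_mult:
  fixes U V :: "'a \<Rightarrow> ennreal"
  assumes "indep_var borel U borel V"
  shows "(\<integral>\<^sup>+\<omega>. U \<omega> * V \<omega> \<partial>M) = (\<integral>\<^sup>+\<omega>. U \<omega> \<partial>M) * (\<integral>\<^sup>+\<omega>. V \<omega> \<partial>M)"
proof -
  have eq: "case_bool borel borel = (\<lambda>_. borel :: ennreal measure)"
    by (simp add: fun_eq_iff split: bool.split)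
  have "indep_vars (\<lambda>_. borel) (case_bool U V) UNIV"
    using assms by (simp add: indep_var_def eq)
  from indep_vars_nn_integral[OF _ this] show ?thesis
    by (simp add: UNIV_bool mult.commute)
qed

text \<open>Doob's maximal inequality for the submartingale of partial products, without martingales: the step
  from \<^term>\<open>m\<close> to \<^term>\<open>Suc m\<close> keeps the mass on the event already reached, because the new
  factor is independent of that event and has mean at least 1, and on the newly reached part of the
  event the product itself is at least \<^term>\<open>a\<close>.\<close>

lemma product_maximal_inequality:
  fixes Y :: "nat \<Rightarrow> 'a \<Rightarrow> ennreal"
  assumes indep: "indep_vars (\<lambda>_. borel) Y {N<..}"
    and mean: "\<And>i. i > N \<Longrightarrow> 1 \<le> (\<integral>\<^sup>+\<omega>. Y i \<omega> \<partial>M)"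
    and "N \<le> m"
  shows "a * emeasure M {\<omega>\<in>space M. \<exists>n\<in>{N..m}. a \<le> (\<Prod>i\<in>{N<..n}. Y i \<omega>)}
           \<le> (\<integral>\<^sup>+\<omega>. (\<Prod>i\<in>{N<..m}. Y i \<omega>) *
                indicator {\<omega>\<in>space M. \<exists>n\<in>{N..m}. a \<le> (\<Prod>i\<in>{N<..n}. Y i \<omega>)} \<omega> \<partial>M)"
  using \<open>N \<le> m\<close>
proof (induction m rule: dec_induct)
  case base
  show ?case
    by (cases "a \<le> 1") (auto simp: emeasure_space_1)
next
  case (step m)
  have [measurable]: "Y i \<in> borel_measurable M" if "i > N" for i
    using indep that by (auto simp: indep_vars_def)
  have [measurable]: "(\<lambda>\<omega>. \<Prod>i\<in>{N<..n}. Y i \<omega>) \<in> borel_measurable M" for n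
    by (intro borel_measurable_prod_ennreal) auto
  define P where "P n \<omega> = (\<Prod>i\<in>{N<..n}. Y i \<omega>)" for n \<omega>
  define A where "A n = {\<omega>\<in>space M. \<exists>k\<in>{N..n}. a \<le> P k \<omega>}" for n
  have P_meas [measurable]: "P n \<in> borel_measurable M" for n
    unfolding P_def by measurable
  have A_meas [measurable]: "A n \<in> sets M" for n
    unfolding A_def by measurable
  have sub: "A m \<subseteq> A (Suc m)"
    by (force simp: A_def)
  have P_Suc: "P (Suc m) \<omega> = P m \<omega> * Y (Suc m) \<omega>" for \<omega>
  proof -
    have "{N<..Suc m} = insert (Suc m) {N<..m}" using step by auto
    then show ?thesis by (simp add: P_def mult.commute)
  qed
  have indep2: "indep_var borel (\<lambda>\<omega>. P m \<omega> * of_bool (\<exists>k\<in>{N..m}. a \<le> P k \<omega>)) borel (Y (Suc m))"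
  proof -
    define f :: "(nat \<Rightarrow> ennreal) \<Rightarrow> ennreal"
      where "f y = (\<Prod>i\<in>{N<..m}. y i) * of_bool (\<exists>k\<in>{N..m}. a \<le> (\<Prod>i\<in>{N<..k}. y i))" for y
    let ?S = "Pi\<^sub>M {N<..m} (\<lambda>_. borel :: ennreal measure)"
    have prod_meas: "(\<lambda>y. \<Prod>i\<in>{N<..k}. y i) \<in> borel_measurable ?S" if "k \<le> m" for k
      using that by (intro borel_measurable_prod_ennreal measurable_component_singleton) auto
    have ind: "Measurable.pred ?S (\<lambda>y. \<exists>k\<in>{N..m}. a \<le> (\<Prod>i\<in>{N<..k}. y i))"
      using prod_meas by (intro pred_intros_finite) (auto intro!: borel_measurable_le)
    have f: "f \<in> borel_measurable ?S"
      unfolding f_def of_bool_def using ind prod_meas[of m] by measurable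
    have "f (restrict (\<lambda>i. Y i \<omega>) {N<..m}) = P m \<omega> * of_bool (\<exists>k\<in>{N..m}. a \<le> P k \<omega>)" for \<omega>
    proof -
      have "(\<Prod>i\<in>{N<..k}. restrict (\<lambda>i. Y i \<omega>) {N<..m} i) = P k \<omega>" if "k \<le> m" for k
        unfolding P_def using that by (intro prod.cong) auto
      then show ?thesis by (simp add: f_def)
    qed
    moreover have "indep_var borel (f \<circ> (\<lambda>\<omega>. restrict (\<lambda>i. Y i \<omega>) {N<..m}))
            borel ((\<lambda>y. y (Suc m)) \<circ> (\<lambda>\<omega>. restrict (\<lambda>i. Y i \<omega>) {Suc m}))"
      using f step
      by (intro indep_var_compose[OF indep_var_restrict[OF indep]]) auto
    ultimately show ?thesis by (simp add: comp_def)
  qed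
  have "a * emeasure M (A m) \<le> (\<integral>\<^sup>+\<omega>. P m \<omega> * indicator (A m) \<omega> \<partial>M) * 1"
    using step.IH by (simp add: A_def P_def)
  also have "\<dots> \<le> (\<integral>\<^sup>+\<omega>. P m \<omega> * indicator (A m) \<omega> \<partial>M) * (\<integral>\<^sup>+\<omega>. Y (Suc m) \<omega> \<partial>M)"
    using mean[of "Suc m"] step by (intro mult_left_mono) auto
  also have "(\<integral>\<^sup>+\<omega>. P m \<omega> * indicator (A m) \<omega> \<partial>M)
      = (\<integral>\<^sup>+\<omega>. P m \<omega> * of_bool (\<exists>k\<in>{N..m}. a \<le> P k \<omega>) \<partial>M)"
    by (intro nn_integral_cong) (auto simp: A_def indicator_def)
  also have "\<dots> * (\<integral>\<^sup>+\<omega>. Y (Suc m) \<omega> \<partial>M)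
      = (\<integral>\<^sup>+\<omega>. P m \<omega> * of_bool (\<exists>k\<in>{N..m}. a \<le> P k \<omega>) * Y (Suc m) \<omega> \<partial>M)"
    by (rule nn_integral_indep_var_mult[OF indep2, symmetric])
  also have "\<dots> = (\<integral>\<^sup>+\<omega>. P (Suc m) \<omega> * indicator (A m) \<omega> \<partial>M)"
    by (intro nn_integral_cong) (auto simp: A_def indicator_def P_Suc)
  finally have old: "a * emeasure M (A m) \<le> \<dots>" .
  have "a * emeasure M (A (Suc m) - A m) = (\<integral>\<^sup>+\<omega>. a * indicator (A (Suc m) - A m) \<omega> \<partial>M)"
    by (subst nn_integral_cmult_indicator) auto
  also have "\<dots> \<le> (\<integral>\<^sup>+\<omega>. P (Suc m) \<omega> * indicator (A (Suc m) - A m) \<omega> \<partial>M)"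
    by (intro nn_integral_mono) (auto simp: A_def indicator_def le_Suc_eq)
  finally have new: "a * emeasure M (A (Suc m) - A m) \<le> \<dots>" .
  have "a * emeasure M (A (Suc m)) = a * emeasure M (A m) + a * emeasure M (A (Suc m) - A m)"
    using sub plus_emeasure[of "A m" M "A (Suc m) - A m"]
    by (simp add: Un_absorb1 flip: distrib_left)
  also have "\<dots> \<le> (\<integral>\<^sup>+\<omega>. P (Suc m) \<omega> * indicator (A m) \<omega> \<partial>M)
      + (\<integral>\<^sup>+\<omega>. P (Suc m) \<omega> * indicator (A (Suc m) - A m) \<omega> \<partial>M)"
    by (intro add_mono old new)
  also have "\<dots> = (\<integral>\<^sup>+\<omega>. P (Suc m) \<omega> * indicator (A (Suc m)) \<omega> \<partial>M)"
    using sub by (subst nn_integral_add[symmetric])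
      (auto intro!: nn_integral_cong simp: indicator_def)
  finally show ?case by (simp add: A_def P_def)
qed

text \<open>Symmetry lets the exponential be replaced by a hyperbolic cosine, which is at least 1. This makes
  the exponentials of the partial sums a submartingale.\<close>

lemma symmetric_exp_mean_ge_1:
  assumes "symmetric_rv Z"
  shows "1 \<le> (\<integral>\<^sup>+\<omega>. ennreal (exp (Re (w * Z \<omega>))) \<partial>M)"
proof -
  have [measurable]: "Z \<in> borel_measurable M" and
    eq: "distr M borel Z = distr M borel (\<lambda>\<omega>. - Z \<omega>)"
    using assms by (auto simp: symmetric_rv_def)
  let ?e = "\<lambda>c Z. ennreal (exp (Re (c * Z)))"
  have "(\<integral>\<^sup>+\<omega>. ?e w (Z \<omega>) \<partial>M) = (\<integral>\<^sup>+u. ?e w u \<partial>distr M borel Z)"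
    by (subst nn_integral_distr) auto
  also have "\<dots> = (\<integral>\<^sup>+\<omega>. ?e w (- Z \<omega>) \<partial>M)"
    unfolding eq by (subst nn_integral_distr) auto
  finally have flip: "(\<integral>\<^sup>+\<omega>. ?e w (Z \<omega>) \<partial>M) = (\<integral>\<^sup>+\<omega>. ?e w (- Z \<omega>) \<partial>M)" .
  have "2 = (\<integral>\<^sup>+\<omega>. 2 \<partial>M)" by (simp add: emeasure_space_1)
  also have "\<dots> \<le> (\<integral>\<^sup>+\<omega>. ?e w (Z \<omega>) + ?e w (- Z \<omega>) \<partial>M)"
  proof (intro nn_integral_mono)
    fix \<omega>
    have "2 \<le> exp (Re (w * Z \<omega>)) + exp (Re (w * - Z \<omega>))"
      using exp_ge_add_one_self[of "Re (w * Z \<omega>)"] exp_ge_add_one_self[of "Re (w * - Z \<omega>)"]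
      unfolding mult_minus_right uminus_complex.sel by linarith
    then show "2 \<le> ?e w (Z \<omega>) + ?e w (- Z \<omega>)"
      by (simp add: ennreal_leI flip: ennreal_plus ennreal_numeral)
  qed
  also have "\<dots> = 2 * (\<integral>\<^sup>+\<omega>. ?e w (Z \<omega>) \<partial>M)"
    by (subst nn_integral_add) (auto simp only: flip[symmetric] mult_2, measurable)
  finally have "2 * 1 \<le> 2 * (\<integral>\<^sup>+\<omega>. ?e w (Z \<omega>) \<partial>M)" by simp
  then show ?thesis by (subst (asm) ennreal_mult_le_mult_iff) auto
qed

end

lemma complex_norm_le_max_rotated_Re:
  assumes "t * sqrt 2 \<le> cmod z"
  shows "\<exists>c\<in>{1, -1, \<i>, -\<i>}. t \<le> Re (c * z)"
proof (rule ccontr)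
  assume "\<not> ?thesis"
  then have "\<bar>Re z\<bar> < t" "\<bar>Im z\<bar> < t" by auto
  then have "(Re z)\<^sup>2 < t\<^sup>2" "(Im z)\<^sup>2 < t\<^sup>2"
    by (metis abs_le_square_iff abs_of_nonneg abs_ge_zero le_less_trans less_imp_le not_le)+
  then have "(cmod z)\<^sup>2 < (t * sqrt 2)\<^sup>2"
    by (simp add: cmod_power2 power_mult_distrib)
  moreover have "0 \<le> t" using \<open>\<bar>Re z\<bar> < t\<close> by linarith
  ultimately show False
    using assms by (meson mult_nonneg_nonneg not_le power_mono real_sqrt_ge_zero zero_le_numeral)
qed

locale sub_gaussian_sequence = prob_space +
  fixes g :: "nat \<Rightarrow> 'a \<Rightarrow> complex"
  assumes indep: "indep_vars (\<lambda>_. borel) g {1..}"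
    and symmetric: "\<And>n. n \<ge> 1 \<Longrightarrow> symmetric_rv (g n)"
    and sub_gaussian: "\<And>n. n \<ge> 1 \<Longrightarrow> sub_gaussian 1 (g n)"
begin

lemma g_measurable [measurable]: "n \<ge> 1 \<Longrightarrow> g n \<in> borel_measurable M"
  using indep by (auto simp: indep_vars_def)

lemma block_sum_measurable [measurable]:
  "(\<lambda>\<omega>. \<Sum>i\<in>{N<..n}. v i * g i \<omega>) \<in> borel_measurable M"
  by (intro borel_measurable_sum borel_measurable_times) auto

text \<open>Chernoff's bound with the maximal inequality in the place of Markov's: the exponent
  \<^term>\<open>l = t / s2\<close> minimises \<^term>\<open>- l * t + l\<^sup>2 * s2 / 2\<close>.\<close>

lemma one_sided_tail_finite:
  fixes v :: "nat \<Rightarrow> complex"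
  assumes var: "(\<Sum>i\<in>{N<..m}. (cmod (v i))\<^sup>2) \<le> s2" and "s2 > 0" "t \<ge> 0" "N \<le> m"
  shows "emeasure M {\<omega>\<in>space M. \<exists>n\<in>{N..m}. t \<le> Re (\<Sum>i\<in>{N<..n}. v i * g i \<omega>)}
           \<le> ennreal (exp (- t\<^sup>2 / (2 * s2)))"
proof -
  define l where "l = t / s2"
  have "l \<ge> 0" using assms by (simp add: l_def)
  define Y where "Y i \<omega> = ennreal (exp (Re (of_real l * v i * g i \<omega>)))" for i \<omega>
  have meas [measurable]: "Y i \<in> borel_measurable M" if "i > N" for i
  proof -
    have "i \<ge> 1" using that by simp
    then show ?thesis unfolding Y_def by measurable
  qed
  have indep_g: "indep_vars (\<lambda>_. borel) g {N<..}"
    by (rule indep_vars_subset[OF indep]) auto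
  have indep_Y: "indep_vars (\<lambda>_. borel) Y {N<..}"
    unfolding Y_def[abs_def] by (rule indep_vars_compose2[OF indep_g]) measurable
  have mean: "1 \<le> (\<integral>\<^sup>+\<omega>. Y i \<omega> \<partial>M)" if "i > N" for i
    unfolding Y_def using that by (intro symmetric_exp_mean_ge_1 symmetric) auto
  have mgf: "(\<integral>\<^sup>+\<omega>. Y i \<omega> \<partial>M) \<le> ennreal (exp (l\<^sup>2 * (cmod (v i))\<^sup>2 / 2))" if "i > N" for i
  proof -
    have "(\<integral>\<^sup>+\<omega>. ennreal (exp (Re (cnj z * g i \<omega>))) \<partial>M)
            \<le> ennreal (exp (1\<^sup>2 * (cmod z)\<^sup>2 / 2))" for z
      using sub_gaussian[of i] that unfolding sub_gaussian_def by auto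
    from this[of "cnj (of_real l * v i)"] show ?thesis
      by (simp add: Y_def norm_mult power_mult_distrib)
  qed
  have prod_Y: "(\<Prod>i\<in>{N<..n}. Y i \<omega>) = ennreal (exp (l * Re (\<Sum>i\<in>{N<..n}. v i * g i \<omega>)))" for n \<omega>
  proof -
    have "(\<Prod>i\<in>{N<..n}. Y i \<omega>) = ennreal (\<Prod>i\<in>{N<..n}. exp (Re (of_real l * v i * g i \<omega>)))"
      unfolding Y_def by (rule prod_ennreal) auto
    also have "(\<Prod>i\<in>{N<..n}. exp (Re (of_real l * v i * g i \<omega>)))
        = exp (\<Sum>i\<in>{N<..n}. l * Re (v i * g i \<omega>))"
      by (subst exp_sum[symmetric]) (auto simp: algebra_simps)
    finally show ?thesis by (simp add: sum_distrib_left)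
  qed
  let ?a = "ennreal (exp (l * t))"
  let ?A = "{\<omega>\<in>space M. \<exists>n\<in>{N..m}. ?a \<le> (\<Prod>i\<in>{N<..n}. Y i \<omega>)}"
  have [measurable]: "(\<lambda>\<omega>. \<Prod>i\<in>{N<..n}. Y i \<omega>) \<in> borel_measurable M" for n
    by (intro borel_measurable_prod_ennreal) auto
  have "?a * emeasure M ?A \<le> (\<integral>\<^sup>+\<omega>. (\<Prod>i\<in>{N<..m}. Y i \<omega>) * indicator ?A \<omega> \<partial>M)"
    by (rule product_maximal_inequality[OF indep_Y mean \<open>N \<le> m\<close>])
  also have "\<dots> \<le> (\<integral>\<^sup>+\<omega>. (\<Prod>i\<in>{N<..m}. Y i \<omega>) \<partial>M)"
    by (intro nn_integral_mono) (auto simp: indicator_def)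
  also have "\<dots> = (\<Prod>i\<in>{N<..m}. \<integral>\<^sup>+\<omega>. Y i \<omega> \<partial>M)"
    by (intro indep_vars_nn_integral indep_vars_subset[OF indep_Y]) auto
  also have "\<dots> \<le> (\<Prod>i\<in>{N<..m}. ennreal (exp (l\<^sup>2 * (cmod (v i))\<^sup>2 / 2)))"
    by (intro prod_mono_ennreal mgf) auto
  also have "\<dots> = ennreal (exp (l\<^sup>2 / 2 * (\<Sum>i\<in>{N<..m}. (cmod (v i))\<^sup>2)))"
    by (subst prod_ennreal) (auto simp: exp_sum sum_distrib_left)
  also have "\<dots> \<le> ennreal (exp (l\<^sup>2 / 2 * s2))"
    using var by (intro ennreal_leI) (simp add: mult_left_mono)
  finally have "?a * emeasure M ?A \<le> ennreal (exp (l\<^sup>2 / 2 * s2))" .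
  then have "ennreal (exp (- (l * t))) * (?a * emeasure M ?A)
      \<le> ennreal (exp (- (l * t))) * ennreal (exp (l\<^sup>2 / 2 * s2))"
    by (rule mult_left_mono) auto
  moreover have "ennreal (exp (- (l * t))) * (?a * emeasure M ?A) = emeasure M ?A"
    by (simp add: mult.assoc[symmetric] ennreal_mult'[symmetric] exp_add[symmetric])
  moreover have "ennreal (exp (- (l * t))) * ennreal (exp (l\<^sup>2 / 2 * s2))
      = ennreal (exp (- t\<^sup>2 / (2 * s2)))"
    using \<open>s2 > 0\<close>
    by (simp add: ennreal_mult'[symmetric] exp_add[symmetric] l_def power2_eq_square field_simps)
  moreover have "emeasure M {\<omega>\<in>space M. \<exists>n\<in>{N..m}. t \<le> Re (\<Sum>i\<in>{N<..n}. v i * g i \<omega>)}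
      \<le> emeasure M ?A"
    using \<open>l \<ge> 0\<close> by (intro emeasure_mono) (auto simp: prod_Y intro!: mult_left_mono)
  ultimately show ?thesis by simp
qed

lemma one_sided_tail:
  fixes v :: "nat \<Rightarrow> complex"
  assumes var: "\<And>m. (\<Sum>i\<in>{N<..m}. (cmod (v i))\<^sup>2) \<le> s2" and "s2 > 0" "t \<ge> 0"
  shows "emeasure M {\<omega>\<in>space M. \<exists>n\<ge>N. t \<le> Re (\<Sum>i\<in>{N<..n}. v i * g i \<omega>)}
           \<le> ennreal (exp (- t\<^sup>2 / (2 * s2)))"
proof -
  let ?A = "\<lambda>m. {\<omega>\<in>space M. \<exists>n\<in>{N..m}. t \<le> Re (\<Sum>i\<in>{N<..n}. v i * g i \<omega>)}"
  have "emeasure M {\<omega>\<in>space M. \<exists>n\<ge>N. t \<le> Re (\<Sum>i\<in>{N<..n}. v i * g i \<omega>)}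
      = emeasure M (\<Union>m. ?A m)"
  proof (intro arg_cong[where f = "emeasure M"])
    have "{\<omega>\<in>space M. \<exists>n\<ge>N. Q n \<omega>} = (\<Union>m. {\<omega>\<in>space M. \<exists>n\<in>{N..m}. Q n \<omega>})" for Q
      by (auto, meson atLeastAtMost_iff order_refl)
    then show "{\<omega>\<in>space M. \<exists>n\<ge>N. t \<le> Re (\<Sum>i\<in>{N<..n}. v i * g i \<omega>)} = (\<Union>m. ?A m)" .
  qed
  also have "\<dots> = (SUP m. emeasure M (?A m))"
  proof (rule SUP_emeasure_incseq[symmetric])
    have "incseq (\<lambda>m. {\<omega>\<in>space M. \<exists>n\<in>{N..m}. Q n \<omega>})" for Q
      by (fastforce simp: incseq_def)
    then show "incseq ?A" .
  qed auto
  also have "\<dots> \<le> ennreal (exp (- t\<^sup>2 / (2 * s2)))"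
  proof (intro SUP_least)
    fix m
    show "emeasure M (?A m) \<le> ennreal (exp (- t\<^sup>2 / (2 * s2)))"
    proof (cases "N \<le> m")
      case False
      then show ?thesis by simp
    qed (use assms one_sided_tail_finite in auto)
  qed
  finally show ?thesis .
qed

text \<open>A complex number is controlled by the real parts of its four rotations by powers of
  \<^term>\<open>\<i>\<close>, up to a factor \<^term>\<open>sqrt 2 :: real\<close>. This costs the constant 4 in front and a
  factor 2 in the exponent.\<close>

lemma block_tail:
  fixes v :: "nat \<Rightarrow> complex"
  assumes var: "\<And>m. (\<Sum>i\<in>{N<..m}. (cmod (v i))\<^sup>2) \<le> s2" and "s2 > 0" "t \<ge> 0"
  shows "emeasure M {\<omega>\<in>space M. \<exists>n\<ge>N. t \<le> cmod (\<Sum>i\<in>{N<..n}. v i * g i \<omega>)}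
           \<le> ennreal (4 * exp (- t\<^sup>2 / (4 * s2)))"
proof -
  let ?A = "\<lambda>c. {\<omega>\<in>space M. \<exists>n\<ge>N. t / sqrt 2 \<le> Re (\<Sum>i\<in>{N<..n}. (c * v i) * g i \<omega>)}"
  let ?C = "{1, -1, \<i>, -\<i>}"
  have "{\<omega>\<in>space M. \<exists>n\<ge>N. t \<le> cmod (\<Sum>i\<in>{N<..n}. v i * g i \<omega>)} \<subseteq> (\<Union>c\<in>?C. ?A c)"
  proof
    fix \<omega> assume "\<omega> \<in> {\<omega>\<in>space M. \<exists>n\<ge>N. t \<le> cmod (\<Sum>i\<in>{N<..n}. v i * g i \<omega>)}"
    then obtain n where n: "\<omega> \<in> space M" "n \<ge> N" "t \<le> cmod (\<Sum>i\<in>{N<..n}. v i * g i \<omega>)" by auto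
    have "\<exists>c\<in>?C. t / sqrt 2 \<le> Re (c * (\<Sum>i\<in>{N<..n}. v i * g i \<omega>))"
      using n(3) by (intro complex_norm_le_max_rotated_Re) simp
    then obtain c where "c \<in> ?C" "t / sqrt 2 \<le> Re (c * (\<Sum>i\<in>{N<..n}. v i * g i \<omega>))" ..
    moreover have "c * (\<Sum>i\<in>{N<..n}. v i * g i \<omega>) = (\<Sum>i\<in>{N<..n}. (c * v i) * g i \<omega>)"
      by (simp add: sum_distrib_left mult.assoc)
    ultimately have "\<omega> \<in> ?A c" using n(1,2) by (simp only: mem_Collect_eq) blast
    with \<open>c \<in> ?C\<close> show "\<omega> \<in> (\<Union>c\<in>?C. ?A c)" by blast
  qed
  then have "emeasure M {\<omega>\<in>space M. \<exists>n\<ge>N. t \<le> cmod (\<Sum>i\<in>{N<..n}. v i * g i \<omega>)}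
      \<le> emeasure M (\<Union>c\<in>?C. ?A c)"
    by (rule emeasure_mono) (intro sets.finite_UN, auto)
  also have "\<dots> \<le> (\<Sum>c\<in>?C. emeasure M (?A c))"
    by (rule emeasure_subadditive_finite) auto
  also have "\<dots> \<le> (\<Sum>c\<in>?C. ennreal (exp (- t\<^sup>2 / (4 * s2))))"
  proof (rule sum_mono)
    fix c assume "c \<in> ?C"
    then have "cmod c = 1" by auto
    then have "emeasure M (?A c) \<le> ennreal (exp (- (t / sqrt 2)\<^sup>2 / (2 * s2)))"
      using assms by (intro one_sided_tail) (auto simp: norm_mult)
    then show "emeasure M (?A c) \<le> ennreal (exp (- t\<^sup>2 / (4 * s2)))"
      by (simp add: power_divide)
  qed
  also have "\<dots> = of_nat (card ?C) * ennreal (exp (- t\<^sup>2 / (4 * s2)))"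
    by (rule sum_constant)
  also have "card ?C = 4"
    by (simp add: complex_eq_iff)
  finally show ?thesis
    by (simp add: ennreal_mult' flip: ennreal_numeral)
qed

end

section \<open>Almost sure convergence and a uniform bound for countably many weights\<close>

lemma sum_block:
  fixes f :: "nat \<Rightarrow> 'a::ab_group_add"
  assumes "N \<le> n"
  shows "sum f {N<..n} = sum f {1..n} - sum f {1..N}"
proof -
  have "{1..n} = {1..N} \<union> {N<..n}" "{1..N} \<inter> {N<..n} = {}" using assms by auto
  then show ?thesis by (simp add: sum.union_disjoint)
qed

lemma (in prob_space) AE_exists_outside:
  assumes "\<And>k::nat. emeasure M (B k) \<le> ennreal (e k)" "\<And>k. B k \<in> sets M" "e \<longlonglongrightarrow> 0"
  shows "AE \<omega> in M. \<exists>k. \<omega> \<notin> B k"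
proof -
  have "emeasure M (\<Inter>k. B k) \<le> ennreal (e k)" for k
    using assms(1)[of k] emeasure_mono[of "\<Inter>k. B k" "B k" M] assms(2) by force
  moreover have "(\<lambda>k. ennreal (e k)) \<longlonglongrightarrow> ennreal 0"
    using assms(3) by (rule tendsto_ennrealI)
  ultimately have "emeasure M (\<Inter>k. B k) \<le> ennreal 0"
    by (intro LIMSEQ_le_const) auto
  then have "(\<Inter>k. B k) \<in> null_sets M"
    using assms(2) by (auto simp: null_sets_def)
  then show ?thesis
    by (rule AE_I') auto
qed

context sub_gaussian_sequence
begin

text \<open>The tail of the square sum tends to 0, so the tail bound makes the probability that the partial
  sums after \<^term>\<open>N\<close> ever oscillate by a fixed amount tend to 0 as well.\<close>

lemma AE_convergent_of_square_summable:
  fixes v :: "nat \<Rightarrow> complex"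
  assumes sm: "summable (\<lambda>k. (cmod (v (Suc k)))\<^sup>2)"
  shows "AE \<omega> in M. convergent (\<lambda>N. \<Sum>n=1..N. v n * g n \<omega>)"
proof -
  define f where "f k = (cmod (v (Suc k)))\<^sup>2" for k
  \<comment> \<open>The summand \<^term>\<open>1 / real (Suc N)\<close> only keeps the variance bound positive when the tail vanishes.\<close>
  define s2 where "s2 N = (suminf f - sum f {..<N}) + 1 / real (Suc N)" for N
  have sumf: "summable f" using sm by (simp add: f_def[abs_def])
  have sum_f: "(\<Sum>i\<in>{1..m}. (cmod (v i))\<^sup>2) = sum f {..<m}" for m
    unfolding f_def by (rule sum.reindex_bij_witness[of _ Suc "\<lambda>i. i - 1"]) auto
  have tail_le: "(\<Sum>i\<in>{N<..m}. (cmod (v i))\<^sup>2) \<le> suminf f - sum f {..<N}" for N m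
  proof (cases "N \<le> m")
    case True
    then have "(\<Sum>i\<in>{N<..m}. (cmod (v i))\<^sup>2) = sum f {..<m} - sum f {..<N}"
      by (simp only: sum_block sum_f)
    then show ?thesis using sum_le_suminf[OF sumf, of "{..<m}"] by (simp add: f_def)
  next
    case False
    then show ?thesis using sum_le_suminf[OF sumf, of "{..<N}"] by (simp add: f_def)
  qed
  have s2_pos: "s2 N > 0" for N
  proof -
    have "0 \<le> suminf f - sum f {..<N}" using tail_le[of N N] by simp
    then show ?thesis by (simp add: s2_def add_nonneg_pos)
  qed
  have s2_var: "(\<Sum>i\<in>{N<..m}. (cmod (v i))\<^sup>2) \<le> s2 N" for N m
    using tail_le[of N m] by (simp add: s2_def add_increasing2)
  have "s2 \<longlonglongrightarrow> (suminf f - suminf f) + 0"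
    unfolding s2_def[abs_def]
    by (intro tendsto_add tendsto_diff tendsto_const summable_LIMSEQ sumf LIMSEQ_Suc[OF lim_1_over_n])
  then have s2_lim: "filterlim s2 (at_right 0) sequentially"
    using s2_pos by (auto simp: filterlim_at less_imp_neq[symmetric] intro!: always_eventually)
  have AE_k: "AE \<omega> in M. \<exists>N. \<forall>n\<ge>N. cmod (\<Sum>i\<in>{N<..n}. v i * g i \<omega>) < e" if "e > 0" for e :: real
  proof -
    let ?B = "\<lambda>N. {\<omega>\<in>space M. \<exists>n\<ge>N. e \<le> cmod (\<Sum>i\<in>{N<..n}. v i * g i \<omega>)}"
    have "((\<lambda>x. 4 * exp (- e\<^sup>2 / (4 * x))) \<longlongrightarrow> 0) (at_right (0::real))"
      using \<open>e > 0\<close> by real_asymp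
    then have "(\<lambda>N. 4 * exp (- e\<^sup>2 / (4 * s2 N))) \<longlonglongrightarrow> 0"
      by (rule filterlim_compose[OF _ s2_lim])
    then have "AE \<omega> in M. \<exists>N. \<omega> \<notin> ?B N"
      using s2_var s2_pos \<open>e > 0\<close>
      by (intro AE_exists_outside[where e = "\<lambda>N. 4 * exp (- e\<^sup>2 / (4 * s2 N))"] block_tail) auto
    then show ?thesis
      by (rule AE_mp) (auto intro!: AE_I2 simp: not_le, meson not_le)
  qed
  have "AE \<omega> in M. \<forall>k. \<exists>N. \<forall>n\<ge>N. cmod (\<Sum>i\<in>{N<..n}. v i * g i \<omega>) < 1 / real (Suc k)"
    by (subst AE_all_countable) (intro allI AE_k, simp)
  then show ?thesis
  proof (rule AE_mp, intro AE_I2 impI)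
    fix \<omega>
    assume small: "\<forall>k. \<exists>N. \<forall>n\<ge>N. cmod (\<Sum>i\<in>{N<..n}. v i * g i \<omega>) < 1 / real (Suc k)"
    let ?S = "\<lambda>N. \<Sum>n=1..N. v n * g n \<omega>"
    have "Cauchy ?S"
    proof (rule metric_CauchyI)
      fix e :: real assume "e > 0"
      then obtain k where k: "1 / real (Suc k) < e / 2"
        using reals_Archimedean[of "e / 2"] by (auto simp: inverse_eq_divide)
      from small obtain N where "\<forall>n\<ge>N. cmod (\<Sum>i\<in>{N<..n}. v i * g i \<omega>) < 1 / real (Suc k)" by blast
      then have N: "dist (?S n) (?S N) < e / 2" if "n \<ge> N" for n
        using that k sum_block[OF that, of "\<lambda>i. v i * g i \<omega>"] unfolding dist_norm by force
      have "dist (?S m) (?S n) < e" if "m \<ge> N" "n \<ge> N" for m n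
        using N[OF that(1)] N[OF that(2)] by (rule dist_triangle_half_l)
      then show "\<exists>N. \<forall>m\<ge>N. \<forall>n\<ge>N. dist (?S m) (?S n) < e" by blast
    qed
    then show "convergent ?S" by (rule Cauchy_convergent)
  qed
qed

text \<open>The tail bound relative to the exact variance. With the variance in the extended half-line, the
  degenerate cases need no separate treatment later: an infinite variance leaves nothing to prove,
  and for variance 0 the sums vanish identically.\<close>

lemma block_tail_normalized:
  fixes v :: "nat \<Rightarrow> complex"
  assumes "u > 0"
  shows "emeasure M {\<omega>\<in>space M. \<exists>n\<ge>N. \<not> ennreal ((cmod (\<Sum>i\<in>{N<..n}. v i * g i \<omega>))\<^sup>2)
             \<le> ennreal (4 * u) * (\<Sum>k. ennreal ((cmod (v (N + 1 + k)))\<^sup>2))}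
           \<le> ennreal (4 * exp (- u))" (is "emeasure M ?Bad \<le> _")
proof -
  let ?V = "\<Sum>k. ennreal ((cmod (v (N + 1 + k)))\<^sup>2)"
  have reindex: "(\<Sum>i\<in>{N<..m}. h i) = (\<Sum>k<m - N. h (N + 1 + k))" for m and h :: "nat \<Rightarrow> ennreal"
    by (rule sum.reindex_bij_witness[of _ "\<lambda>k. N + 1 + k" "\<lambda>i. i - N - 1"]) auto
  have var: "(\<Sum>i\<in>{N<..m}. ennreal ((cmod (v i))\<^sup>2)) \<le> ?V" for m
    unfolding reindex by (rule sum_le_suminf) auto
  have trichotomy: "x = \<infinity> \<or> x = 0 \<or> (\<exists>r>0. x = ennreal r)" for x :: ennreal
    by (cases x) (auto simp: order.order_iff_strict)
  consider "?V = \<infinity>" | "?V = 0" | s2 where "?V = ennreal s2" "s2 > 0"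
    using trichotomy[of ?V] by blast
  then show ?thesis
  proof cases
    case 1
    then have "?Bad = {}" using assms by (simp add: ennreal_mult_top)
    then have "emeasure M ?Bad = 0" by (simp only: emeasure_empty)
    then show ?thesis by (simp only: zero_le)
  next
    case 2
    then have "v i = 0" if "i > N" for i
    proof -
      have "ennreal ((cmod (v (N + 1 + (i - N - 1))))\<^sup>2) = 0"
        using 2 by (subst (asm) suminf_eq_zero_iff) (auto simp: ennreal_eq_zero_iff)
      then show ?thesis using that by (simp add: ennreal_eq_0_iff)
    qed
    then have "?Bad = {}" by auto
    then have "emeasure M ?Bad = 0" by (simp only: emeasure_empty)
    then show ?thesis by (simp only: zero_le)
  next
    case 3
    define t where "t = sqrt (4 * u * s2)"
    have t: "t \<ge> 0" "t\<^sup>2 / (4 * s2) = u" using 3 assms by (auto simp: t_def)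
    have s2: "(\<Sum>i\<in>{N<..m}. (cmod (v i))\<^sup>2) \<le> s2" for m
      using var[of m] 3 by (simp add: sum_ennreal)
    have "t \<le> cmod z" if "\<not> ennreal ((cmod z)\<^sup>2) \<le> ennreal (4 * u) * ?V" for z
    proof -
      have "4 * u * s2 < (cmod z)\<^sup>2"
        using that 3 assms by (simp add: ennreal_mult'[symmetric] not_le ennreal_less_iff)
      then show ?thesis unfolding t_def by (intro real_le_lsqrt) auto
    qed
    then have "?Bad \<subseteq> {\<omega>\<in>space M. \<exists>n\<ge>N. t \<le> cmod (\<Sum>i\<in>{N<..n}. v i * g i \<omega>)}"
      by blast
    then have "emeasure M ?Bad \<le> emeasure M {\<omega>\<in>space M. \<exists>n\<ge>N. t \<le> cmod (\<Sum>i\<in>{N<..n}. v i * g i \<omega>)}"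
      by (rule emeasure_mono) measurable
    also have "\<dots> \<le> ennreal (4 * exp (- t\<^sup>2 / (4 * s2)))"
      by (rule block_tail[OF s2 \<open>s2 > 0\<close> t(1)])
    also have "- t\<^sup>2 / (4 * s2) = - u"
      using t(2) by simp
    finally show ?thesis .
  qed
qed

text \<open>This is where the factors \<^term>\<open>sqrt (ln (real (N + 2)))\<close> and \<^term>\<open>sqrt (real (Suc j))\<close>
  of the final estimate come from: with them, the failure probability at \<^term>\<open>(N, j)\<close> is a power
  of \<^term>\<open>1 / real (N + 2)\<close> with exponent proportional to \<^term>\<open>Suc j\<close>, which beats the exponential
  number of indices at level \<^term>\<open>j\<close> and is summable in \<^term>\<open>N\<close>. The total failure probability
  moreover tends to 0 as \<^term>\<open>k\<close> grows, so some \<^term>\<open>k\<close> works almost surely for all indices at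
  once. The random constant thus absorbs the finitely many exceptions that a Borel-Cantelli argument
  would leave.\<close>

lemma AE_uniform_block_bound:
  fixes v :: "'i \<Rightarrow> nat \<Rightarrow> complex" and I :: "nat \<Rightarrow> 'i set"
  assumes fin: "\<And>j. finite (I j)" and card: "\<And>j. real (card (I j)) \<le> A * 2 ^ (p * j)"
  shows "AE \<omega> in M. \<exists>k::nat. \<forall>N j. \<forall>i\<in>I j. \<forall>n\<ge>N.
           ennreal ((cmod (\<Sum>l\<in>{N<..n}. v i l * g l \<omega>))\<^sup>2)
             \<le> ennreal (4 * (real (Suc k) * real (Suc j) * ln (real (N + 2))))
                * (\<Sum>l. ennreal ((cmod (v i (N + 1 + l)))\<^sup>2))"
proof -
  define good where "good k N j i \<omega> \<longleftrightarrow> (\<forall>n\<ge>N. ennreal ((cmod (\<Sum>l\<in>{N<..n}. v i l * g l \<omega>))\<^sup>2)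
             \<le> ennreal (4 * (real (Suc k) * real (Suc j) * ln (real (N + 2))))
                * (\<Sum>l. ennreal ((cmod (v i (N + 1 + l)))\<^sup>2)))" for k N j :: nat and i \<omega>
  have good_meas [measurable]: "Measurable.pred M (good k N j i)" for k N j i
    unfolding good_def[abs_def] by measurable
  have "A \<ge> 0" using card[of 0] by simp
  define Bad where "Bad k = {\<omega>\<in>space M. \<exists>N j. \<exists>i\<in>I j. \<not> good k N j i \<omega>}" for k
  \<comment> \<open>The shift by \<^term>\<open>p + 1\<close> provides the power of 2 that beats the number of indices.\<close>
  let ?q = "\<lambda>q. q + p + 1"
  have one: "emeasure M {\<omega>\<in>space M. \<not> good (?q q) N j i \<omega>} 
      \<le> ennreal (4 * ((1/2)^q * (1/2)^(p * j) * (1/2)^j * (1 / (real (N + 2))\<^sup>2)))" for q N j i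
  proof -
    let ?u = "real (Suc (?q q)) * real (Suc j) * ln (real (N + 2))"
    let ?n = "real (N + 2)"
    have tail: "emeasure M {\<omega>\<in>space M. \<not> good (?q q) N j i \<omega>} \<le> ennreal (4 * exp (- ?u))"
      unfolding good_def not_all not_imp by (rule block_tail_normalized) simp
    have "exp (- (real m * ln ?n)) = (1 / ?n) ^ m" for m
    proof -
      have "exp (- (real m * ln ?n)) = inverse (exp (ln ?n) ^ m)"
        by (simp only: exp_minus exp_of_nat_mult)
      then show ?thesis by (simp add: power_one_over inverse_eq_divide)
    qed
    from this[of "Suc (?q q) * Suc j"] have "exp (- ?u) = (1 / ?n) ^ (Suc (?q q) * Suc j)"
      by (simp only: of_nat_mult)
    also have "\<dots> \<le> (1 / ?n) ^ (q + p * j + j + 2)"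
      by (intro power_decreasing) (auto simp: algebra_simps)
    also have "\<dots> = (1 / ?n) ^ (q + p * j + j) * (1 / ?n\<^sup>2)"
      by (simp add: power_add power_divide power2_eq_square)
    also have "\<dots> \<le> (1/2) ^ (q + p * j + j) * (1 / ?n\<^sup>2)"
      by (intro mult_right_mono power_mono) (auto simp: field_simps)
    finally have "exp (- ?u) \<le> (1/2)^q * (1/2)^(p * j) * (1/2)^j * (1 / ?n\<^sup>2)"
      by (simp only: power_add)
    then show ?thesis
      by (intro order_trans[OF tail] ennreal_leI mult_left_mono) auto
  qed
  have level: "emeasure M {\<omega>\<in>space M. \<exists>i\<in>I j. \<not> good (?q q) N j i \<omega>} 
      \<le> ennreal (4 * A * (1/2)^q * (1 / (real (N + 2))\<^sup>2) * (1/2)^j)" for q N j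
  proof -
    let ?b = "4 * ((1/2)^q * (1/2)^(p * j) * (1/2)^j * (1 / (real (N + 2))\<^sup>2))"
    have "{\<omega>\<in>space M. \<exists>i\<in>I j. \<not> good (?q q) N j i \<omega>} = (\<Union>i\<in>I j. {\<omega>\<in>space M. \<not> good (?q q) N j i \<omega>})"
      by auto
    then have "emeasure M {\<omega>\<in>space M. \<exists>i\<in>I j. \<not> good (?q q) N j i \<omega>}
        \<le> (\<Sum>i\<in>I j. emeasure M {\<omega>\<in>space M. \<not> good (?q q) N j i \<omega>})"
      using fin by (simp, intro emeasure_subadditive_finite) auto
    also have "\<dots> \<le> (\<Sum>i\<in>I j. ennreal ?b)"
      by (intro sum_mono one)
    also have "\<dots> = ennreal (real (card (I j)) * ?b)"
      by (simp only: sum_constant ennreal_of_nat_eq_real_of_nat ennreal_mult'[OF of_nat_0_le_iff])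
    also have "\<dots> \<le> ennreal (A * 2 ^ (p * j) * ?b)"
      by (intro ennreal_leI mult_right_mono card) auto
    also have "A * 2 ^ (p * j) * ?b = 4 * A * (1/2)^q * (1 / (real (N + 2))\<^sup>2) * (1/2)^j"
      by (simp add: power_divide mult_ac)
    finally show ?thesis .
  qed
  define Z where "Z = (\<Sum>N. 1 / (real (N + 2))\<^sup>2)"
  have sumZ: "summable (\<lambda>N. 1 / (real (N + 2))\<^sup>2)"
    using summable_ignore_initial_segment[OF inverse_power_summable[of 2, where 'a = real], of 2]
    by (simp add: divide_inverse)
  have Bad_le: "emeasure M (Bad (?q q)) \<le> ennreal (8 * A * Z * (1/2)^q)" for q
  proof -
    have "Bad (?q q) = (\<Union>N. \<Union>j. {\<omega>\<in>space M. \<exists>i\<in>I j. \<not> good (?q q) N j i \<omega>})"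
      by (auto simp: Bad_def)
    then have "emeasure M (Bad (?q q)) \<le> (\<Sum>N. emeasure M (\<Union>j. {\<omega>\<in>space M. \<exists>i\<in>I j. \<not> good (?q q) N j i \<omega>}))"
      using fin by (simp, intro emeasure_subadditive_countably) (auto intro!: pred_intros_finite)
    also have "\<dots> \<le> (\<Sum>N. \<Sum>j. emeasure M {\<omega>\<in>space M. \<exists>i\<in>I j. \<not> good (?q q) N j i \<omega>})"
      using fin by (intro suminf_le emeasure_subadditive_countably) auto
    also have "\<dots> \<le> (\<Sum>N. \<Sum>j. ennreal (4 * A * (1/2)^q * (1 / (real (N + 2))\<^sup>2) * (1/2)^j))"
      by (intro suminf_le level) auto
    also have "\<dots> = (\<Sum>N. ennreal (8 * A * (1/2)^q * (1 / (real (N + 2))\<^sup>2)))"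
    proof (rule suminf_cong)
      fix N
      have "(\<lambda>j. 4 * A * (1/2)^q * (1 / (real (N + 2))\<^sup>2) * (1/2)^j) sums
          (4 * A * (1/2)^q * (1 / (real (N + 2))\<^sup>2) * (1 / (1 - 1/2)))"
        by (intro sums_mult geometric_sums) auto
      then show "(\<Sum>j. ennreal (4 * A * (1/2)^q * (1 / (real (N + 2))\<^sup>2) * (1/2)^j))
          = ennreal (8 * A * (1/2)^q * (1 / (real (N + 2))\<^sup>2))"
        using \<open>A \<ge> 0\<close> by (subst suminf_ennreal_eq) (auto simp: algebra_simps)
    qed
    also have "\<dots> = ennreal (8 * A * (1/2)^q * Z)"
    proof -
      have "(\<lambda>N. 8 * A * (1/2)^q * (1 / (real (N + 2))\<^sup>2)) sums (8 * A * (1/2)^q * Z)"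
        unfolding Z_def by (intro sums_mult summable_sums sumZ)
      then show ?thesis using \<open>A \<ge> 0\<close> by (subst suminf_ennreal_eq) auto
    qed
    finally show ?thesis by (simp add: mult_ac)
  qed
  have "(\<lambda>q. 8 * A * Z * (1/2)^q) \<longlonglongrightarrow> 8 * A * Z * 0"
    by (intro tendsto_intros LIMSEQ_power_zero) auto
  then have "AE \<omega> in M. \<exists>q. \<omega> \<notin> Bad (?q q)"
    using Bad_le fin
    by (intro AE_exists_outside[where e = "\<lambda>q. 8 * A * Z * (1/2)^q"])
       (auto simp: Bad_def intro!: pred_intros_finite)
  then show ?thesis
  proof (rule AE_mp, intro AE_I2 impI)
    fix \<omega> assume "\<omega> \<in> space M" "\<exists>q. \<omega> \<notin> Bad (?q q)"
    then obtain q where "\<forall>N j. \<forall>i\<in>I j. good (?q q) N j i \<omega>" by (auto simp: Bad_def)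
    then show "\<exists>k::nat. \<forall>N j. \<forall>i\<in>I j. \<forall>n\<ge>N.
           ennreal ((cmod (\<Sum>l\<in>{N<..n}. v i l * g l \<omega>))\<^sup>2)
             \<le> ennreal (4 * (real (Suc k) * real (Suc j) * ln (real (N + 2))))
                * (\<Sum>l. ennreal ((cmod (v i (N + 1 + l)))\<^sup>2))"
      unfolding good_def by blast
  qed
qed

end

section \<open>Random weights independent of the noise\<close>

text \<open>Fubini's theorem: the joint law of an independent pair is the product of the laws, so a property
  may be verified with the second component frozen.\<close>

lemma (in prob_space) AE_indep_pair:
  assumes indep: "indep_pair N X N' Y"
    and meas: "Measurable.pred (N' \<Otimes>\<^sub>M N) (\<lambda>z. P (snd z) (fst z))"
    and AE: "\<And>y. y \<in> space N' \<Longrightarrow> AE \<omega> in M. P (X \<omega>) y"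
  shows "AE \<omega> in M. P (X \<omega>) (Y \<omega>)"
proof -
  from indep have [measurable]: "X \<in> M \<rightarrow>\<^sub>M N" "Y \<in> M \<rightarrow>\<^sub>M N'"
    and ind: "indep_set (sets (vimage_algebra (space M) X N)) (sets (vimage_algebra (space M) Y N'))"
    by (auto simp: indep_pair_def)
  interpret X: prob_space "distr M N X" by (rule prob_space_distr) measurable
  interpret Y: prob_space "distr M N' Y" by (rule prob_space_distr) measurable
  interpret YX: pair_sigma_finite "distr M N' Y" "distr M N X" ..
  let ?J = "distr M (N' \<Otimes>\<^sub>M N) (\<lambda>\<omega>. (Y \<omega>, X \<omega>))"
  have joint: "distr M N' Y \<Otimes>\<^sub>M distr M N X = ?J"
  proof (rule pair_measure_eqI)
    show "sets (distr M N' Y \<Otimes>\<^sub>M distr M N X) = sets ?J"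
      by (simp cong: sets_pair_measure_cong)
  next
    fix B A assume "B \<in> sets (distr M N' Y)" "A \<in> sets (distr M N X)"
    then have [measurable]: "B \<in> sets N'" "A \<in> sets N" by auto
    let ?XA = "X -` A \<inter> space M" and ?YB = "Y -` B \<inter> space M"
    have "prob (?XA \<inter> ?YB) = prob ?XA * prob ?YB"
      by (intro indep_setD[OF ind]) (auto intro: in_vimage_algebra)
    then have "emeasure M (?XA \<inter> ?YB) = emeasure M ?XA * emeasure M ?YB"
      by (simp add: emeasure_eq_measure ennreal_mult)
    moreover have "(\<lambda>\<omega>. (Y \<omega>, X \<omega>)) -` (B \<times> A) \<inter> space M = ?XA \<inter> ?YB"
      by auto
    ultimately show "emeasure (distr M N' Y) B * emeasure (distr M N X) A = emeasure ?J (B \<times> A)"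
      by (simp add: emeasure_distr mult.commute)
  qed (rule Y.sigma_finite_measure_axioms X.sigma_finite_measure_axioms)+
  have "AE z in distr M N' Y \<Otimes>\<^sub>M distr M N X. P (snd z) (fst z)"
  proof (rule YX.AE_pair_measure)
    have [measurable]: "Measurable.pred (distr M N' Y \<Otimes>\<^sub>M distr M N X) (\<lambda>z. P (snd z) (fst z))"
      using meas by (simp cong: measurable_cong_sets sets_pair_measure_cong)
    show "{z \<in> space (distr M N' Y \<Otimes>\<^sub>M distr M N X). P (snd z) (fst z)}
        \<in> sets (distr M N' Y \<Otimes>\<^sub>M distr M N X)"
      by measurable
  next
    have AE_section: "AE x in distr M N X. P x y" if "y \<in> space N'" for y
    proof (subst AE_distr_iff)
      have "Measurable.pred N (\<lambda>x. P (snd (y, x)) (fst (y, x)))"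
        by (rule measurable_compose[OF measurable_Pair1'[OF that] meas])
      then show "{x \<in> space N. P x y} \<in> sets N" by simp
    qed (use AE[OF that] in auto)
    show "AE y in distr M N' Y. AE x in distr M N X. P (snd (y, x)) (fst (y, x))"
      by (rule AE_I2) (simp add: AE_section)
  qed
  then have "AE z in ?J. P (snd z) (fst z)" by (simp only: joint)
  from AE_distrD[OF _ this] show ?thesis by simp
qed

context sub_gaussian_sequence
begin

text \<open>Conditionally on the weights the two preceding results apply to deterministic weights. Both events
  involve only countably many points, which makes them measurable. The weights enter through their
  increments over the points of one level \<^term>\<open>D j\<close>; the pairs number at most the square of
  \<^term>\<open>card (D j)\<close>, still exponential in \<^term>\<open>j\<close>.\<close>

lemma AE_random_weights:
  fixes W :: "nat \<Rightarrow> 'b \<Rightarrow> 'a \<Rightarrow> complex" and D :: "nat \<Rightarrow> 'b set"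
  assumes indep_W: "indep_pair
          (\<Pi>\<^sub>M n\<in>{1..}. borel) (\<lambda>\<omega>. \<lambda>n\<in>{1..}. g n \<omega>)
          (\<Pi>\<^sub>M p\<in>{1..} \<times> K. borel) (\<lambda>\<omega>. \<lambda>p\<in>{1..} \<times> K. W (fst p) (snd p) \<omega>)"
    and fin: "\<And>j. finite (D j)" and sub: "\<And>j. D j \<subseteq> K"
    and card: "\<And>j. real (card (D j)) \<le> A * 2 ^ (p * j)"
  shows "AE \<omega> in M. \<exists>k::nat. \<forall>N j. \<forall>x\<in>D j. \<forall>y\<in>D j. \<forall>n\<ge>N.
           ennreal ((cmod (\<Sum>l\<in>{N<..n}. (W l x \<omega> - W l y \<omega>) * g l \<omega>))\<^sup>2)
             \<le> ennreal (4 * (real (Suc k) * real (Suc j) * ln (real (N + 2))))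
                * (\<Sum>l. ennreal ((cmod (W (N + 1 + l) x \<omega> - W (N + 1 + l) y \<omega>))\<^sup>2))" (is ?bound)
    and "AE \<omega> in M. \<forall>j. \<forall>x\<in>D j. (\<Sum>l. ennreal ((cmod (W (Suc l) x \<omega>))\<^sup>2)) < \<infinity> \<longrightarrow>
           convergent (\<lambda>N. \<Sum>n=1..N. W n x \<omega> * g n \<omega>)" (is ?conv)
proof -
  let ?N = "\<Pi>\<^sub>M n\<in>{1::nat..}. (borel :: complex measure)"
  let ?N' = "\<Pi>\<^sub>M p\<in>{1::nat..} \<times> K. (borel :: complex measure)"
  have g_comp [measurable]: "(\<lambda>z. snd z l) \<in> borel_measurable (?N' \<Otimes>\<^sub>M ?N)" if "l \<ge> 1" for l
    using that by (intro measurable_compose[OF measurable_snd] measurable_component_singleton) auto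
  have W_comp [measurable]: "(\<lambda>z. fst z (l, x)) \<in> borel_measurable (?N' \<Otimes>\<^sub>M ?N)"
    if "l \<ge> 1" "x \<in> K" for l x
    using that by (intro measurable_compose[OF measurable_fst] measurable_component_singleton) auto
  define P where "P k N j x y n G w \<longleftrightarrow>
      ennreal ((cmod (\<Sum>l\<in>{N<..n}. (w (l, x) - w (l, y)) * G l))\<^sup>2)
             \<le> ennreal (4 * (real (Suc k) * real (Suc j) * ln (real (N + 2))))
                * (\<Sum>l. ennreal ((cmod (w (N + 1 + l, x) - w (N + 1 + l, y)))\<^sup>2))"
    for k N j n :: nat and x y and G :: "nat \<Rightarrow> complex" and w :: "nat \<times> 'b \<Rightarrow> complex"
  have P_meas: "Measurable.pred (?N' \<Otimes>\<^sub>M ?N) (\<lambda>z. P k N j x y n (snd z) (fst z))"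
    if [simp]: "x \<in> K" "y \<in> K" for k N j x y n
  proof -
    have [measurable]: "(\<lambda>z. \<Sum>l\<in>{N<..n}. (fst z (l, x) - fst z (l, y)) * snd z l)
        \<in> borel_measurable (?N' \<Otimes>\<^sub>M ?N)"
      by (intro borel_measurable_sum borel_measurable_times borel_measurable_diff) auto
    have [measurable]: "(\<lambda>z. fst z (N + 1 + l, x) - fst z (N + 1 + l, y)) \<in> borel_measurable (?N' \<Otimes>\<^sub>M ?N)" for l
      by (intro borel_measurable_diff W_comp) auto
    show ?thesis unfolding P_def by measurable
  qed
  have "AE \<omega> in M. (\<lambda>G w. \<exists>k. \<forall>N j. \<forall>x\<in>D j. \<forall>y\<in>D j. \<forall>n\<ge>N. P k N j x y n G w)
      (\<lambda>n\<in>{1..}. g n \<omega>) (\<lambda>p\<in>{1..} \<times> K. W (fst p) (snd p) \<omega>)"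
  proof (rule AE_indep_pair[OF indep_W])
    show "Measurable.pred (?N' \<Otimes>\<^sub>M ?N)
        (\<lambda>z. \<exists>k. \<forall>N j. \<forall>x\<in>D j. \<forall>y\<in>D j. \<forall>n\<ge>N. P k N j x y n (snd z) (fst z))"
      using fin sub
      by (intro pred_intros_countable pred_intros_finite pred_intros_logic P_meas) auto
  next
    fix w :: "nat \<times> 'b \<Rightarrow> complex"
    define v where "v = (\<lambda>(x, y) l. w (l, x) - w (l, y))"
    have "AE \<omega> in M. \<exists>k::nat. \<forall>N j. \<forall>i\<in>D j \<times> D j. \<forall>n\<ge>N.
           ennreal ((cmod (\<Sum>l\<in>{N<..n}. v i l * g l \<omega>))\<^sup>2)
             \<le> ennreal (4 * (real (Suc k) * real (Suc j) * ln (real (N + 2))))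
                * (\<Sum>l. ennreal ((cmod (v i (N + 1 + l)))\<^sup>2))"
    proof (rule AE_uniform_block_bound[where A = "A\<^sup>2" and p = "2 * p"])
      fix j
      have "(real (card (D j)))\<^sup>2 \<le> (A * 2 ^ (p * j))\<^sup>2"
        by (intro power_mono card) auto
      also have "\<dots> = A\<^sup>2 * 2 ^ (2 * p * j)"
        by (simp add: power_mult_distrib mult_ac flip: power_mult)
      finally show "real (card (D j \<times> D j)) \<le> A\<^sup>2 * 2 ^ (2 * p * j)"
        by (simp add: card_cartesian_product power2_eq_square)
    qed (use fin in auto)
    then show "AE \<omega> in M. \<exists>k. \<forall>N j. \<forall>x\<in>D j. \<forall>y\<in>D j. \<forall>n\<ge>N. P k N j x y n (\<lambda>n\<in>{1..}. g n \<omega>) w"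
    proof (rule AE_mp, intro AE_I2 impI)
      fix \<omega>
      let ?G = "\<lambda>n\<in>{1..}. g n \<omega>"
      assume "\<exists>k::nat. \<forall>N j. \<forall>i\<in>D j \<times> D j. \<forall>n\<ge>N.
           ennreal ((cmod (\<Sum>l\<in>{N<..n}. v i l * g l \<omega>))\<^sup>2)
             \<le> ennreal (4 * (real (Suc k) * real (Suc j) * ln (real (N + 2))))
                * (\<Sum>l. ennreal ((cmod (v i (N + 1 + l)))\<^sup>2))"
      then obtain k where k: "ennreal ((cmod (\<Sum>l\<in>{N<..n}. v i l * g l \<omega>))\<^sup>2)
             \<le> ennreal (4 * (real (Suc k) * real (Suc j) * ln (real (N + 2))))
                * (\<Sum>l. ennreal ((cmod (v i (N + 1 + l)))\<^sup>2))"
        if "i \<in> D j \<times> D j" "n \<ge> N" for N j i n by blast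
      have "P k N j x y n ?G w" if "x \<in> D j" "y \<in> D j" "n \<ge> N" for N j x y n
      proof -
        have G: "(\<Sum>l\<in>{N<..n}. (w (l, x) - w (l, y)) * ?G l)
            = (\<Sum>l\<in>{N<..n}. (w (l, x) - w (l, y)) * g l \<omega>)"
          by (intro sum.cong) auto
        have v: "v (x, y) l = w (l, x) - w (l, y)" for l by (simp add: v_def)
        show ?thesis
          unfolding P_def G by (rule k[of "(x, y)", unfolded v]) (use that in auto)
      qed
      then show "\<exists>k. \<forall>N j. \<forall>x\<in>D j. \<forall>y\<in>D j. \<forall>n\<ge>N. P k N j x y n ?G w" by blast
    qed
  qed
  then show ?bound
  proof (rule AE_mp, intro AE_I2 impI)
    fix \<omega>
    let ?G = "\<lambda>n\<in>{1..}. g n \<omega>" and ?w = "\<lambda>p\<in>{1..} \<times> K. W (fst p) (snd p) \<omega>"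
    assume "\<exists>k. \<forall>N j. \<forall>x\<in>D j. \<forall>y\<in>D j. \<forall>n\<ge>N. P k N j x y n ?G ?w"
    then obtain k where k: "P k N j x y n ?G ?w" if "x \<in> D j" "y \<in> D j" "n \<ge> N" for N j x y n
      by blast
    have "ennreal ((cmod (\<Sum>l\<in>{N<..n}. (W l x \<omega> - W l y \<omega>) * g l \<omega>))\<^sup>2)
             \<le> ennreal (4 * (real (Suc k) * real (Suc j) * ln (real (N + 2))))
                * (\<Sum>l. ennreal ((cmod (W (N + 1 + l) x \<omega> - W (N + 1 + l) y \<omega>))\<^sup>2))"
      if xy: "x \<in> D j" "y \<in> D j" "n \<ge> N" for N j x y n
    proof -
      have [simp]: "x \<in> K" "y \<in> K" using xy sub by auto
      have G: "(\<Sum>l\<in>{N<..n}. (?w (l, x) - ?w (l, y)) * ?G l)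
          = (\<Sum>l\<in>{N<..n}. (W l x \<omega> - W l y \<omega>) * g l \<omega>)"
        by (intro sum.cong) auto
      have w: "?w (N + 1 + l, z) = W (N + 1 + l) z \<omega>" if "z \<in> K" for l z
        using that by auto
      show ?thesis
        using k[OF xy] unfolding P_def G w[OF \<open>x \<in> K\<close>] w[OF \<open>y \<in> K\<close>] .
    qed
    then show "\<exists>k::nat. \<forall>N j. \<forall>x\<in>D j. \<forall>y\<in>D j. \<forall>n\<ge>N.
           ennreal ((cmod (\<Sum>l\<in>{N<..n}. (W l x \<omega> - W l y \<omega>) * g l \<omega>))\<^sup>2)
             \<le> ennreal (4 * (real (Suc k) * real (Suc j) * ln (real (N + 2))))
                * (\<Sum>l. ennreal ((cmod (W (N + 1 + l) x \<omega> - W (N + 1 + l) y \<omega>))\<^sup>2))"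
      by blast
  qed
  define Q where "Q x G w \<longleftrightarrow> ((\<Sum>l. ennreal ((cmod (w (Suc l, x)))\<^sup>2)) < \<infinity> \<longrightarrow>
      Cauchy (\<lambda>N. \<Sum>n=1..N. w (n, x) * G n))" for x and G :: "nat \<Rightarrow> complex" and w :: "nat \<times> 'b \<Rightarrow> complex"
  have Q_meas: "Measurable.pred (?N' \<Otimes>\<^sub>M ?N) (\<lambda>z. Q x (snd z) (fst z))"
    if [simp]: "x \<in> K" for x
  proof -
    have [measurable]: "(\<lambda>z. \<Sum>n=1..N. fst z (n, x) * snd z n) \<in> borel_measurable (?N' \<Otimes>\<^sub>M ?N)" for N
      by (intro borel_measurable_sum borel_measurable_times) auto
    have [measurable]: "(\<lambda>z. fst z (Suc l, x)) \<in> borel_measurable (?N' \<Otimes>\<^sub>M ?N)" for l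
      by (intro W_comp) auto
    show ?thesis unfolding Q_def by measurable
  qed
  have "AE \<omega> in M. (\<lambda>G w. \<forall>j. \<forall>x\<in>D j. Q x G w)
      (\<lambda>n\<in>{1..}. g n \<omega>) (\<lambda>p\<in>{1..} \<times> K. W (fst p) (snd p) \<omega>)"
  proof (rule AE_indep_pair[OF indep_W])
    show "Measurable.pred (?N' \<Otimes>\<^sub>M ?N) (\<lambda>z. \<forall>j. \<forall>x\<in>D j. Q x (snd z) (fst z))"
      using fin sub by (intro pred_intros_countable pred_intros_finite Q_meas) auto
  next
    fix w :: "nat \<times> 'b \<Rightarrow> complex"
    have "AE \<omega> in M. Q x (\<lambda>n\<in>{1..}. g n \<omega>) w" for x
    proof (cases "(\<Sum>l. ennreal ((cmod (w (Suc l, x)))\<^sup>2)) < \<infinity>")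
      case True
      then have "summable (\<lambda>l. (cmod (w (Suc l, x)))\<^sup>2)"
        by (intro summable_suminf_not_top) auto
      then have "AE \<omega> in M. convergent (\<lambda>N. \<Sum>n=1..N. w (n, x) * g n \<omega>)"
        by (rule AE_convergent_of_square_summable[where v = "\<lambda>n. w (n, x)"])
      then show ?thesis
      proof (rule AE_mp, intro AE_I2 impI)
        fix \<omega> assume "convergent (\<lambda>N. \<Sum>n=1..N. w (n, x) * g n \<omega>)"
        then have "Cauchy (\<lambda>N. \<Sum>n=1..N. w (n, x) * g n \<omega>)"
          by (rule convergent_Cauchy)
        moreover have G: "(\<Sum>n=1..N. w (n, x) * (\<lambda>n\<in>{1..}. g n \<omega>) n) = (\<Sum>n=1..N. w (n, x) * g n \<omega>)" for N
          by (intro sum.cong) auto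
        ultimately show "Q x (\<lambda>n\<in>{1..}. g n \<omega>) w"
          unfolding Q_def G by blast
      qed
    qed (simp add: Q_def)
    then show "AE \<omega> in M. \<forall>j. \<forall>x\<in>D j. Q x (\<lambda>n\<in>{1..}. g n \<omega>) w"
      using fin by (simp add: AE_all_countable AE_finite_all)
  qed
  then show ?conv
  proof (rule AE_mp, intro AE_I2 impI allI ballI)
    fix \<omega> j x
    let ?G = "\<lambda>n\<in>{1..}. g n \<omega>" and ?w = "\<lambda>p\<in>{1..} \<times> K. W (fst p) (snd p) \<omega>"
    assume *: "\<forall>j. \<forall>x\<in>D j. Q x ?G ?w" "x \<in> D j" "(\<Sum>l. ennreal ((cmod (W (Suc l) x \<omega>))\<^sup>2)) < \<infinity>"
    then have [simp]: "x \<in> K" using sub by auto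
    have G: "(\<Sum>n=1..N. ?w (n, x) * ?G n) = (\<Sum>n=1..N. W n x \<omega> * g n \<omega>)" for N
      by (intro sum.cong) auto
    have w: "?w (Suc l, x) = W (Suc l) x \<omega>" for l
      using \<open>x \<in> K\<close> by simp
    have "Q x ?G ?w" using * by blast
    then have "Cauchy (\<lambda>N. \<Sum>n=1..N. W n x \<omega> * g n \<omega>)"
      using *(3) unfolding Q_def G w by blast
    then show "convergent (\<lambda>N. \<Sum>n=1..N. W n x \<omega> * g n \<omega>)"
      by (rule Cauchy_convergent)
  qed
qed

end

section \<open>Finite nets of exponential size for a quasi-metric\<close>

lemma interval_grid_point:
  fixes a b x :: real
  assumes "a \<le> x" "x \<le> b" "m > 0"
  shows "\<exists>k\<le>m. \<bar>x - (a + (b - a) * (real k / real m))\<bar> \<le> (b - a) / real m"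
proof (cases "a = b")
  case True
  then have "x = a" "b = a" using assms by auto
  then show ?thesis by (intro exI[of _ 0]) simp
next
  case False
  define u where "u = real m * ((x - a) / (b - a))"
  have "a < b" using assms False by simp
  have u: "0 \<le> u" "u \<le> real m"
    using assms \<open>a < b\<close> by (auto simp: u_def field_simps)
  let ?k = "nat \<lfloor>u\<rfloor>"
  have k: "real ?k \<le> u" "u < real ?k + 1" using u by linarith+
  have "x - (a + (b - a) * (real ?k / real m)) = (b - a) / real m * (u - real ?k)"
    using assms \<open>a < b\<close> by (simp add: u_def field_simps)
  also have "\<bar>\<dots>\<bar> \<le> (b - a) / real m * 1"
  proof -
    have "\<bar>u - real ?k\<bar> \<le> 1" using k by linarith
    then show ?thesis unfolding abs_mult using \<open>a < b\<close> by (intro mult_mono) auto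
  qed
  finally have "\<bar>x - (a + (b - a) * (real ?k / real m))\<bar> \<le> (b - a) / real m" by simp
  moreover have "?k \<le> m" using k u by linarith
  ultimately show ?thesis by blast
qed

lemma cbox_finite_net:
  fixes a b :: "real ^ 'd"
  assumes ne: "cbox a b \<noteq> {}" and "m > 0"
  shows "\<exists>D. finite D \<and> D \<subseteq> cbox a b \<and> card D \<le> Suc m ^ CARD('d) \<and>
           (\<forall>x\<in>cbox a b. \<exists>y\<in>D. norm (x - y) \<le> (\<Sum>i\<in>UNIV. b $ i - a $ i) / real m)"
proof -
  let ?pt = "\<lambda>f :: 'd \<Rightarrow> nat. (\<chi> i. a $ i + (b $ i - a $ i) * (real (f i) / real m)) :: real ^ 'd"
  let ?F = "Pi\<^sub>E (UNIV :: 'd set) (\<lambda>_. {..m})"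
  have ab: "a $ i \<le> b $ i" for i using ne by (auto simp: interval_ne_empty_cart)
  have fin: "finite ?F" by (intro finite_PiE) auto
  have "card (?pt ` ?F) \<le> card ?F" by (rule card_image_le[OF fin])
  also have "card ?F = Suc m ^ CARD('d)" by (simp add: card_PiE)
  finally have "card (?pt ` ?F) \<le> Suc m ^ CARD('d)" .
  moreover have "?pt ` ?F \<subseteq> cbox a b"
  proof (clarsimp simp: mem_box_cart)
    fix f :: "'d \<Rightarrow> nat" and i assume "f \<in> UNIV \<rightarrow>\<^sub>E {..m}"
    then have "f i \<le> m" by auto
    then have "(b $ i - a $ i) * (real (f i) / real m) \<le> (b $ i - a $ i) * 1"
      using \<open>m > 0\<close> ab[of i] by (intro mult_left_mono) auto
    moreover have "0 \<le> (b $ i - a $ i) * (real (f i) / real m)" using ab[of i] by simp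
    ultimately show "0 \<le> (b $ i - a $ i) * real (f i) / real m \<and>
       a $ i + (b $ i - a $ i) * real (f i) / real m \<le> b $ i" by simp
  qed
  moreover have "\<exists>y\<in>?pt ` ?F. norm (x - y) \<le> (\<Sum>i\<in>UNIV. b $ i - a $ i) / real m" if "x \<in> cbox a b" for x
  proof -
    have "\<exists>k\<le>m. \<bar>x $ i - (a $ i + (b $ i - a $ i) * (real k / real m))\<bar> \<le> (b $ i - a $ i) / real m" for i
      using that \<open>m > 0\<close> by (intro interval_grid_point) (auto simp: mem_box_cart)
    then obtain f where f: "f i \<le> m"
      "\<bar>x $ i - (a $ i + (b $ i - a $ i) * (real (f i) / real m))\<bar> \<le> (b $ i - a $ i) / real m" for i
      by metis
    have "norm (x - ?pt f) \<le> (\<Sum>i\<in>UNIV. \<bar>(x - ?pt f) $ i\<bar>)" by (rule norm_le_l1_cart)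
    also have "\<dots> \<le> (\<Sum>i\<in>UNIV. (b $ i - a $ i) / real m)"
      using f(2) by (intro sum_mono) simp
    finally have "norm (x - ?pt f) \<le> (\<Sum>i\<in>UNIV. b $ i - a $ i) / real m"
      by (simp add: sum_divide_distrib)
    moreover have "f \<in> ?F" using f(1) by auto
    ultimately show ?thesis by blast
  qed
  moreover have "finite (?pt ` ?F)" using fin by (rule finite_imageI)
  ultimately show ?thesis by (intro exI[of _ "?pt ` ?F"] conjI ballI)
qed

text \<open>A grid with mesh proportional to \<^term>\<open>(1/2) ^ (q * j)\<close>, where \<^term>\<open>q\<close> is about
  \<^term>\<open>1 / H\<close>, is fine enough: the Hoelder bound turns the mesh into \<^term>\<open>\<rho>\<close>-distance at most
  \<^term>\<open>(1/2) ^ j\<close>, and the number of grid points stays exponential in \<^term>\<open>j\<close>.\<close>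

lemma quasi_metric_net:
  fixes a b :: "real ^ 'd" and \<rho> :: "real ^ 'd \<Rightarrow> real ^ 'd \<Rightarrow> real"
  assumes ne: "cbox a b \<noteq> {}" and "H > 0" "c > 0"
    and upper: "\<And>x y. norm (x - y) \<le> 1 \<Longrightarrow> \<rho> x y \<le> c * norm (x - y) powr H"
  shows "\<exists>D A p. \<forall>j::nat. finite (D j) \<and> D j \<subseteq> cbox a b \<and> real (card (D j)) \<le> A * 2 ^ (p * j) \<and>
           (\<forall>x\<in>cbox a b. \<exists>y\<in>D j. norm (x - y) \<le> (1/2) ^ j \<and> \<rho> x y \<le> (1/2) ^ j)"
proof -
  define q where "q = nat \<lceil>1 / H\<rceil> + 1"
  have q: "1 \<le> H * real q" "1 \<le> q"
  proof -
    have "1 / H \<le> real q" by (simp add: q_def) linarith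
    then show "1 \<le> H * real q" using \<open>H > 0\<close> by (simp add: field_simps)
  qed (simp add: q_def)
  define R where "R = max 1 (c powr (1 / H))"
  have R: "R \<ge> 1" "c * (1 / R) powr H \<le> 1"
  proof -
    have "c = (c powr (1 / H)) powr H" using \<open>c > 0\<close> \<open>H > 0\<close> by (simp add: powr_powr)
    also have "\<dots> \<le> R powr H" using \<open>H > 0\<close> by (intro powr_mono2) (auto simp: R_def)
    finally have "c \<le> R powr H" .
    moreover have "R > 0" by (simp add: R_def)
    ultimately show "c * (1 / R) powr H \<le> 1"
      by (simp add: powr_divide field_simps)
  qed (simp add: R_def)
  let ?L = "\<Sum>i\<in>UNIV. b $ i - a $ i"
  define R' where "R' = nat \<lceil>?L * R\<rceil> + 1"
  have R': "?L * R \<le> real R'" "R' \<ge> 1" by (auto simp: R'_def) linarith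
  define m where "m j = R' * 2 ^ (q * j)" for j
  have "m j > 0" for j using R' by (simp add: m_def)
  then have "\<forall>j. \<exists>D. finite D \<and> D \<subseteq> cbox a b \<and> card D \<le> Suc (m j) ^ CARD('d) \<and>
           (\<forall>x\<in>cbox a b. \<exists>y\<in>D. norm (x - y) \<le> ?L / real (m j))"
    using cbox_finite_net[OF ne] by blast
  from choice[OF this] obtain D where "\<forall>j. finite (D j) \<and> D j \<subseteq> cbox a b \<and>
      card (D j) \<le> Suc (m j) ^ CARD('d) \<and>
      (\<forall>x\<in>cbox a b. \<exists>y\<in>D j. norm (x - y) \<le> ?L / real (m j))" by blast
  then have D: "finite (D j)" "D j \<subseteq> cbox a b" "card (D j) \<le> Suc (m j) ^ CARD('d)"
    "\<forall>x\<in>cbox a b. \<exists>y\<in>D j. norm (x - y) \<le> ?L / real (m j)" for j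
    by blast+
  let ?A = "real ((2 * R') ^ CARD('d))" and ?p = "q * CARD('d)"
  have card_D: "real (card (D j)) \<le> ?A * 2 ^ (?p * j)" for j
  proof -
    have "card (D j) \<le> (2 * m j) ^ CARD('d)"
      using D(3)[of j] \<open>m j > 0\<close> by (intro order_trans[OF D(3)] power_mono) auto
    also have "\<dots> = (2 * R') ^ CARD('d) * 2 ^ (?p * j)"
      by (simp add: m_def power_mult_distrib mult_ac flip: power_mult)
    finally have "real (card (D j)) \<le> real ((2 * R') ^ CARD('d) * 2 ^ (?p * j))"
      by (simp only: of_nat_le_iff)
    then show ?thesis by simp
  qed
  have close: "norm (x - y) \<le> (1/2) ^ j \<and> \<rho> x y \<le> (1/2) ^ j"
    if le: "norm (x - y) \<le> ?L / real (m j)" for x y j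
  proof
    have half: "(1/2::real) ^ (q * j) \<le> (1/2) ^ j"
      using q(2) by (intro power_decreasing) auto
    have "?L / real (m j) = (?L * R / real R') * (1 / R * (1/2) ^ (q * j))"
      using R R' by (simp add: m_def power_divide)
    also have "\<dots> \<le> 1 * (1 / R * (1/2) ^ (q * j))"
      using R R' by (intro mult_right_mono) auto
    finally have n1: "norm (x - y) \<le> 1 / R * (1/2) ^ (q * j)" using le by simp
    also have "\<dots> \<le> 1 * (1/2) ^ (q * j)" using R by (intro mult_right_mono) auto
    finally have "norm (x - y) \<le> (1/2) ^ (q * j)" by simp
    from this half show n2: "norm (x - y) \<le> (1/2) ^ j" by (rule order_trans)
    also have "\<dots> \<le> 1" by (simp add: power_le_one)
    finally have "\<rho> x y \<le> c * norm (x - y) powr H" by (rule upper)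
    also have "\<dots> \<le> c * (1 / R * (1/2) ^ (q * j)) powr H"
      using \<open>c > 0\<close> \<open>H > 0\<close> n1 by (intro mult_left_mono powr_mono2) auto
    also have "\<dots> = (c * (1 / R) powr H) * ((1/2) ^ (q * j)) powr H"
      using R by (subst powr_mult) auto
    also have "\<dots> \<le> 1 * ((1/2) ^ (q * j)) powr H"
      using R by (intro mult_right_mono) auto
    also have "\<dots> = (1/2) powr (H * real q * real j)"
      by (simp add: powr_realpow[symmetric] powr_powr mult_ac)
    also have "\<dots> \<le> (1/2) powr (1 * real j)"
      by (intro powr_mono' mult_right_mono q(1)) auto
    finally show "\<rho> x y \<le> (1/2) ^ j" by (simp add: powr_realpow)
  qed
  show ?thesis
  proof (intro exI[of _ D] exI[of _ ?A] exI[of _ ?p] allI conjI card_D D(1,2) ballI)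
    fix j x assume "x \<in> cbox a b"
    then show "\<exists>y\<in>D j. norm (x - y) \<le> (1/2) ^ j \<and> \<rho> x y \<le> (1/2) ^ j"
      using D(4)[of j] close[of x _ j] by meson
  qed
qed

section \<open>The power-logarithmic modulus on dyadic scales\<close>

text \<open>The real-valued form of \<^term>\<open>log_modulus\<close>, with which it agrees for arguments in
  \<^term>\<open>{0..<1 :: real}\<close>.\<close>

definition log_power :: "real \<Rightarrow> real \<Rightarrow> real \<Rightarrow> real" where
  "log_power \<beta> p h = h powr \<beta> * \<bar>ln h\<bar> powr p"

lemma log_power_nonneg: "0 \<le> log_power \<beta> p h"
  by (simp add: log_power_def)

lemma log_power_0 [simp]: "log_power \<beta> p 0 = 0"
  by (simp add: log_power_def)

text \<open>In the variable \<^term>\<open>t = - ln u\<close> the function is \<^term>\<open>exp (- \<beta> * t + p * ln t)\<close>, whose exponent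
  decreases once \<^term>\<open>t \<ge> \<bar>p\<bar> / \<beta>\<close>.\<close>

lemma log_power_mono:
  assumes "\<beta> > 0" "0 \<le> u" "u \<le> v" "v < 1" "\<bar>p\<bar> / \<beta> \<le> - ln v"
  shows "log_power \<beta> p u \<le> log_power \<beta> p v"
proof (cases "u = 0")
  case False
  define s t where "s = - ln v" and "t = - ln u"
  have uv: "0 < u" "0 < v" using assms False by auto
  have st: "0 < s" "s \<le> t" using assms uv by (auto simp: s_def t_def)
  have form: "log_power \<beta> p (exp (- r)) = exp (- \<beta> * r + p * ln r)" if "r > 0" for r
    using that by (simp add: log_power_def powr_def exp_add[symmetric] abs_if mult_ac)
  have "p * (ln t - ln s) \<le> \<bar>p\<bar> * (ln t - ln s)"
    using st by (intro mult_right_mono) auto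
  also have "ln t - ln s = ln (t / s)" using st by (simp add: ln_div)
  also have "\<bar>p\<bar> * ln (t / s) \<le> \<bar>p\<bar> * (t / s - 1)"
    using st by (intro mult_left_mono ln_le_minus_one) auto
  also have "\<dots> = \<bar>p\<bar> / s * (t - s)" using st by (simp add: field_simps)
  also have "\<dots> \<le> \<beta> * (t - s)"
    using st assms(1,5) by (intro mult_right_mono) (auto simp: s_def field_simps)
  finally have "- \<beta> * t + p * ln t \<le> - \<beta> * s + p * ln s"
    using st by (simp add: algebra_simps ln_div)
  then have "log_power \<beta> p (exp (- t)) \<le> log_power \<beta> p (exp (- s))"
    using st by (simp add: form)
  then show ?thesis using uv by (simp add: s_def t_def)
qed (use assms in \<open>simp add: log_power_nonneg\<close>)

lemma powr_comparable:
  fixes a x p :: real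
  assumes "a > 0" "a / 4 \<le> x" "x \<le> a"
  shows "x powr p \<le> 4 powr \<bar>p\<bar> * a powr p" "a powr p \<le> 4 powr \<bar>p\<bar> * x powr p"
proof -
  have "x > 0" using assms by linarith
  define r where "r = a / x"
  have r: "1 \<le> r" "r \<le> 4" using assms \<open>x > 0\<close> by (auto simp: r_def field_simps)
  have bound: "r powr q \<le> 4 powr \<bar>p\<bar>" if "\<bar>q\<bar> = \<bar>p\<bar>" for q
  proof -
    have "r powr q \<le> r powr \<bar>p\<bar>" using r that by (intro powr_mono) auto
    also have "\<dots> \<le> 4 powr \<bar>p\<bar>" using r by (intro powr_mono2) auto
    finally show ?thesis .
  qed
  have "a powr p = r powr p * x powr p"
    using \<open>x > 0\<close> \<open>a > 0\<close> by (simp add: r_def powr_divide)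
  then show "a powr p \<le> 4 powr \<bar>p\<bar> * x powr p"
    using bound[of p] by (simp add: mult_right_mono)
  have "x powr p = r powr (- p) * a powr p"
    using \<open>x > 0\<close> \<open>a > 0\<close> by (simp add: r_def powr_divide powr_minus field_simps)
  then show "x powr p \<le> 4 powr \<bar>p\<bar> * a powr p"
    using bound[of "- p"] by (simp add: mult_right_mono)
qed

lemma ln_half_power: "ln ((1/2::real) ^ j) = - (real j * ln 2)"
  by (simp add: ln_realpow ln_div)

text \<open>On the dyadic scale \<^term>\<open>(1/2) ^ j\<close> the logarithm is comparable to \<^term>\<open>real j + 1\<close>, within a
  factor 4, as soon as \<^term>\<open>j\<close> is large enough to dominate \<^term>\<open>ln c\<close>.\<close>

lemma log_power_dyadic_le:
  assumes "c \<ge> 1" "j \<ge> 3" "2 * ln c \<le> real j * ln 2"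
  shows "log_power \<beta> p (c * (1/2) ^ j)
    \<le> c powr \<beta> * 4 powr \<bar>p\<bar> * (((1/2) ^ j) powr \<beta> * (real j + 1) powr p)"
proof -
  define l where "l = real j * ln 2"
  have "ln (c * (1/2) ^ j) = ln c - l"
    using assms(1) by (simp add: ln_mult ln_half_power l_def)
  moreover have "2 * ln c \<le> l" using assms(3) by (simp add: l_def)
  moreover have "0 \<le> ln c" using assms(1) by simp
  moreover have "real j * (2/3) \<le> l" "l \<le> real j * 1"
    unfolding l_def using ln2_ge_two_thirds ln_le_minus_one[of "2::real"]
    by (intro mult_left_mono; simp)+
  moreover have "3 \<le> real j" using assms(2) by simp
  ultimately have "(real j + 1) / 4 \<le> \<bar>ln (c * (1/2) ^ j)\<bar>" "\<bar>ln (c * (1/2) ^ j)\<bar> \<le> real j + 1"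
    by (simp_all add: abs_if)
  then have "\<bar>ln (c * (1/2) ^ j)\<bar> powr p \<le> 4 powr \<bar>p\<bar> * (real j + 1) powr p"
    by (intro powr_comparable) auto
  then have "(c * (1/2) ^ j) powr \<beta> * \<bar>ln (c * (1/2) ^ j)\<bar> powr p
      \<le> (c * (1/2) ^ j) powr \<beta> * (4 powr \<bar>p\<bar> * (real j + 1) powr p)"
    by (rule mult_left_mono) auto
  then show ?thesis
    using assms(1) by (simp add: log_power_def powr_mult mult_ac)
qed

lemma log_power_ge_dyadic:
  assumes "(1/2) ^ Suc J < h" "h \<le> (1/2) ^ J" "J \<ge> 3" "\<beta> > 0"
  shows "((1/2) ^ J) powr \<beta> * (real J + 1) powr p \<le> 2 powr \<beta> * 4 powr \<bar>p\<bar> * log_power \<beta> p h"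
proof -
  have "h > 0" using assms(1) by (rule less_trans[rotated]) simp
  have "ln ((1/2) ^ Suc J) \<le> ln h" "ln h \<le> ln ((1/2) ^ J)"
    using assms \<open>h > 0\<close> by (subst ln_le_cancel_iff; simp)+
  then have l: "real J * ln 2 \<le> - ln h" "- ln h \<le> real (Suc J) * ln 2"
    by (simp_all only: ln_half_power)
  have "real J * (2/3) \<le> real J * ln 2" and "real (Suc J) * ln 2 \<le> real (Suc J) * 1"
    using ln2_ge_two_thirds ln_le_minus_one[of "2::real"] by (intro mult_left_mono; simp)+
  from order_trans[OF this(1) l(1)] order_trans[OF l(2) this(2)]
  have "real J * (2/3) \<le> - ln h" "- ln h \<le> real J + 1" by simp_all
  moreover have "3 \<le> real J" using assms(3) by simp
  ultimately have "(real J + 1) / 4 \<le> \<bar>ln h\<bar>" "\<bar>ln h\<bar> \<le> real J + 1"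
    by (simp_all add: abs_if)
  then have log: "(real J + 1) powr p \<le> 4 powr \<bar>p\<bar> * \<bar>ln h\<bar> powr p"
    by (intro powr_comparable) auto
  have "(1/2) ^ J \<le> 2 * h" using assms(1) by simp
  then have "((1/2) ^ J) powr \<beta> \<le> (2 * h) powr \<beta>"
    using \<open>\<beta> > 0\<close> by (intro powr_mono2) auto
  also have "\<dots> = 2 powr \<beta> * h powr \<beta>" using \<open>h > 0\<close> by (simp add: powr_mult)
  finally have "((1/2) ^ J) powr \<beta> * (real J + 1) powr p
      \<le> 2 powr \<beta> * h powr \<beta> * (4 powr \<bar>p\<bar> * \<bar>ln h\<bar> powr p)"
    by (intro mult_mono log) auto
  then show ?thesis by (simp add: log_power_def mult_ac)
qed

lemma summable_geometric_times_powr: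
  assumes "\<beta> > (0::real)"
  shows "summable (\<lambda>i. ((1/2) powr \<beta>) ^ i * (real i + 1) powr p)"
proof -
  define d where "d = \<beta> * ln 2"
  have "d > 0" using assms by (simp add: d_def)
  have pow: "((1/2) powr \<beta>) ^ i = exp (- (d * real i))" for i
    by (simp add: d_def powr_def ln_div mult_ac flip: exp_of_nat_mult)
  have "summable (\<lambda>i. exp (- (d / 2)) ^ i)"
    using \<open>d > 0\<close> by (intro summable_geometric) simp
  moreover have "exp (- (d / 2)) ^ i = exp (- (d / 2 * real i))" for i
    by (simp add: mult_ac flip: exp_of_nat_mult)
  ultimately have "summable (\<lambda>i. norm (exp (- (d / 2 * real i))))" by simp
  moreover have "(\<lambda>i. exp (- (d * real i)) * (real i + 1) powr p) \<in> O(\<lambda>i. exp (- (d / 2 * real i)))"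
    using \<open>d > 0\<close> by real_asymp
  ultimately show ?thesis
    unfolding pow by (rule summable_comparison_test_bigo)
qed

text \<open>Summing the modulus over all finer scales costs only a constant, since
  \<^term>\<open>(J + i + 1) / (J + 1)\<close> lies between 1 and \<^term>\<open>i + 1\<close> and the geometric factor absorbs any power of the latter.\<close>

lemma sum_dyadic_tail_le:
  fixes \<beta> p :: real
  assumes "\<beta> > 0"
  defines "Z \<equiv> \<Sum>i. ((1/2) powr \<beta>) ^ i * (real i + 1) powr \<bar>p\<bar>"
  shows "(\<Sum>i<n. ((1/2) ^ (J + i)) powr \<beta> * (real (J + i) + 1) powr p)
    \<le> Z * (((1/2) ^ J) powr \<beta> * (real J + 1) powr p)"
proof -
  let ?r = "(1/2::real) powr \<beta>"
  have summand: "((1/2) ^ (J + i)) powr \<beta> * (real (J + i) + 1) powr p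
      \<le> (?r ^ i * (real i + 1) powr \<bar>p\<bar>) * (((1/2) ^ J) powr \<beta> * (real J + 1) powr p)" for i
  proof -
    define q where "q = (real (J + i) + 1) / (real J + 1)"
    have q: "1 \<le> q" "q \<le> real i + 1" by (auto simp: q_def field_simps)
    have "(real (J + i) + 1) powr p = q powr p * (real J + 1) powr p"
      by (simp add: q_def powr_divide)
    also have "q powr p \<le> q powr \<bar>p\<bar>" using q by (intro powr_mono) auto
    also have "\<dots> \<le> (real i + 1) powr \<bar>p\<bar>" using q by (intro powr_mono2) auto
    finally have "(real (J + i) + 1) powr p \<le> (real i + 1) powr \<bar>p\<bar> * (real J + 1) powr p"
      by (simp add: mult_right_mono)
    moreover have "((1/2) ^ (J + i)) powr \<beta> = ?r ^ i * ((1/2) ^ J) powr \<beta>"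
      by (simp add: power_add powr_mult powr_powr mult_ac flip: powr_realpow)
    ultimately show ?thesis
      by (simp add: mult_left_mono mult_ac)
  qed
  have "(\<Sum>i<n. ((1/2) ^ (J + i)) powr \<beta> * (real (J + i) + 1) powr p)
      \<le> (\<Sum>i<n. ?r ^ i * (real i + 1) powr \<bar>p\<bar>) * (((1/2) ^ J) powr \<beta> * (real J + 1) powr p)"
    unfolding sum_distrib_right by (rule sum_mono) (rule summand)
  also have "\<dots> \<le> Z * (((1/2) ^ J) powr \<beta> * (real J + 1) powr p)"
    unfolding Z_def using assms
    by (intro mult_right_mono sum_le_suminf summable_geometric_times_powr) auto
  finally show ?thesis .
qed

lemma dyadic_scale:
  fixes h :: real
  assumes "0 < h" "h \<le> (1/2) ^ J0"
  obtains J where "J0 \<le> J" "(1/2) ^ Suc J < h" "h \<le> (1/2) ^ J"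
proof -
  define n where "n = (LEAST n. (1/2) ^ n < h)"
  obtain n0 where "(1/2) ^ n0 < h" using real_arch_pow_inv[of h "1/2"] assms by auto
  then have n: "(1/2) ^ n < h" unfolding n_def by (rule LeastI)
  have "J0 < n"
  proof (rule ccontr)
    assume "\<not> J0 < n"
    then have "(1/2::real) ^ J0 \<le> (1/2) ^ n" by (intro power_decreasing) auto
    then show False using n assms(2) by linarith
  qed
  moreover have "\<not> (1/2) ^ (n - 1) < h"
    using not_less_Least[of "n - 1" "\<lambda>n. (1/2) ^ n < h"] \<open>J0 < n\<close> by (simp add: n_def)
  ultimately show ?thesis using n by (intro that[of "n - 1"]) auto
qed

section \<open>Chaining along the nets\<close>

text \<open>The nets approximate in both distances: in \<^term>\<open>\<rho>\<close>, because the links of a chain have to be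
  measured at exactly the scale \<^term>\<open>(1/2) ^ j\<close> of the modulus, and in the ambient distance, because
  chains have to converge and to stay near the centre. Chaining along dyadic scales of the ambient
  distance would not do: the powers of it that bound \<^term>\<open>\<rho>\<close> from above and from below may
  have different exponents, and their ratio would multiply the exponent of the modulus.\<close>

locale quasi_metric_nets =
  fixes K :: "'b::metric_space set" and \<rho> :: "'b \<Rightarrow> 'b \<Rightarrow> real" and D :: "nat \<Rightarrow> 'b set"
    and \<kappa> H c :: real
  assumes nonneg: "\<And>x y. 0 \<le> \<rho> x y" and zero_iff: "\<And>x y. \<rho> x y = 0 \<longleftrightarrow> x = y"
    and sym: "\<And>x y. \<rho> x y = \<rho> y x"
    and \<kappa>: "1 \<le> \<kappa>" and triangle: "\<And>x y z. \<rho> x z \<le> \<kappa> * (\<rho> x y + \<rho> y z)"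
    and H: "0 < H" and upper: "\<And>x y. dist x y \<le> 1 \<Longrightarrow> \<rho> x y \<le> c * dist x y powr H"
    and c: "0 < c"
    and D_sub: "\<And>j. D j \<subseteq> K"
    and D_net: "\<And>j x. x \<in> K \<Longrightarrow> \<exists>y\<in>D j. dist x y \<le> (1/2) ^ j \<and> \<rho> x y \<le> (1/2) ^ j"
begin

text \<open>If \<^term>\<open>(1/2) ^ J\<close> is the scale of \<^term>\<open>\<rho> x y\<close>, then both points are joined to their
  approximations in \<^term>\<open>D J\<close> through all finer nets, and these two approximations are at
  distance of order \<^term>\<open>(1/2) ^ J\<close>. The factor \<^term>\<open>sqrt (real (Suc j))\<close> in the increments raises
  the exponent of the logarithm by one half. The radius and the constant depend neither on the function
  \<^term>\<open>T\<close> nor on \<^term>\<open>Q\<close>, so the estimate can be applied to all block sums at once.\<close>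

lemma chaining:
  assumes "\<beta> > 0" "\<gamma> > 0"
  obtains \<gamma>' C where "0 < \<gamma>'" "\<gamma>' < \<gamma>" "0 < C"
    and "\<And>x y. x \<in> cball x0 \<gamma>' \<Longrightarrow> y \<in> cball x0 \<gamma>' \<Longrightarrow>
          \<rho> x y < 1 \<and> log_power \<beta> (\<eta> + 1/2) (\<rho> x y) \<le> C"
    and "\<And>(T :: 'b \<Rightarrow> 'c::real_normed_vector) Q x y.
          \<lbrakk>continuous_on K T; 0 \<le> Q;
           \<And>j u v. u \<in> (D j \<union> D (Suc j)) \<inter> cball x0 \<gamma> \<Longrightarrow> v \<in> (D j \<union> D (Suc j)) \<inter> cball x0 \<gamma> \<Longrightarrow>
             \<rho> u v < 1 \<Longrightarrow> norm (T u - T v) \<le> Q * sqrt (real (Suc j)) * log_power \<beta> \<eta> (\<rho> u v);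
           x \<in> cball x0 \<gamma>' \<inter> K; y \<in> cball x0 \<gamma>' \<inter> K\<rbrakk>
          \<Longrightarrow> norm (T x - T y) \<le> Q * C * log_power \<beta> (\<eta> + 1/2) (\<rho> x y)"
proof -
  define p where "p = \<eta> + 1/2"
  \<comment> \<open>By the quasi-triangle inequality, every link at level \<^term>\<open>j\<close> has length at most \<^term>\<open>c3 * (1/2) ^ j\<close>.\<close>
  define c3 where "c3 = 3 * \<kappa>\<^sup>2"
  have "1 \<le> \<kappa>\<^sup>2" "\<kappa> \<le> \<kappa>\<^sup>2"
    using \<kappa> mult_left_mono[of 1 \<kappa> \<kappa>] by (auto simp: power2_eq_square intro: order_trans)
  then have c3: "1 \<le> c3" "3 * \<kappa> \<le> c3" unfolding c3_def by linarith+
  \<comment> \<open>Beyond this threshold for \<^term>\<open>- ln h\<close> the moduli with both exponents \<^term>\<open>\<eta>\<close> and \<^term>\<open>p\<close> are monotone.\<close>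
  define m where "m = 1 + \<bar>\<eta>\<bar> / \<beta> + \<bar>p\<bar> / \<beta>"
  have m: "1 \<le> m" "\<bar>\<eta>\<bar> / \<beta> \<le> m" "\<bar>p\<bar> / \<beta> \<le> m" using \<open>\<beta> > 0\<close> by (auto simp: m_def)
  have "\<forall>\<^sub>F j in sequentially. 3 \<le> j \<and> 2 * ln c3 \<le> real j * ln 2
      \<and> m \<le> real j * ln 2 - ln c3 \<and> (1/2) ^ j \<le> \<gamma> / 2"
  proof (intro eventually_conj)
    show "\<forall>\<^sub>F j in sequentially. (1/2) ^ j \<le> \<gamma> / 2"
      using \<open>\<gamma> > 0\<close> by real_asymp
  qed real_asymp+
  then obtain J0 where J0: "3 \<le> j \<and> 2 * ln c3 \<le> real j * ln 2
      \<and> m \<le> real j * ln 2 - ln c3 \<and> (1/2) ^ j \<le> \<gamma> / 2" if "j \<ge> J0" for j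
    by (auto simp: eventually_sequentially)
  have "\<forall>\<^sub>F t in at_right 0. 0 < t \<and> 2 * t \<le> 1 \<and> t < \<gamma> / 2 \<and> c * (2 * t) powr H \<le> (1/2) ^ J0"
  proof (intro eventually_conj)
    have "((\<lambda>t. c * (2 * t) powr H) \<longlongrightarrow> 0) (at_right 0)"
      using H by real_asymp
    then have "\<forall>\<^sub>F t in at_right 0. c * (2 * t) powr H < (1/2) ^ J0"
      by (rule order_tendstoD(2)) simp
    then show "\<forall>\<^sub>F t in at_right 0. c * (2 * t) powr H \<le> (1/2) ^ J0"
      by (rule eventually_mono) simp
    show "\<forall>\<^sub>F t in at_right 0. t < \<gamma> / 2" using \<open>\<gamma> > 0\<close> by real_asymp
  qed real_asymp+
  then obtain \<gamma>' where \<gamma>': "0 < \<gamma>'" "2 * \<gamma>' \<le> 1" "\<gamma>' < \<gamma> / 2" "c * (2 * \<gamma>') powr H \<le> (1/2) ^ J0"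
    using eventually_happens[of _ "at_right (0::real)"] by (auto simp: trivial_limit_at_right_real)
  have small: "\<rho> x y \<le> (1/2) ^ J0" if "x \<in> cball x0 \<gamma>'" "y \<in> cball x0 \<gamma>'" for x y
  proof -
    have d: "dist x y \<le> 2 * \<gamma>'"
      using dist_triangle3[of x y x0] that by simp
    then have "\<rho> x y \<le> c * dist x y powr H" using \<gamma>' by (intro upper) simp
    also have "\<dots> \<le> c * (2 * \<gamma>') powr H"
      using d c H by (intro mult_left_mono powr_mono2) auto
    finally show ?thesis using \<gamma>' by simp
  qed
  have scale: "c3 * (1/2) ^ j < 1" "\<bar>\<eta>\<bar> / \<beta> \<le> - ln (c3 * (1/2) ^ j)" if "j \<ge> J0" for j
  proof -
    have "m \<le> - ln (c3 * (1/2) ^ j)"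
      using J0[OF that] c3 by (simp add: ln_mult ln_half_power)
    then show "\<bar>\<eta>\<bar> / \<beta> \<le> - ln (c3 * (1/2) ^ j)" "c3 * (1/2) ^ j < 1"
      using m c3 by (auto simp flip: ln_less_zero_iff)
  qed
  define E where "E = c3 powr \<beta> * 4 powr \<bar>\<eta>\<bar>"
  define Z where "Z = (\<Sum>i. ((1/2) powr \<beta>) ^ i * (real i + 1) powr \<bar>p\<bar>)"
  have "Z \<ge> 0"
    unfolding Z_def using \<open>\<beta> > 0\<close> by (intro suminf_nonneg summable_geometric_times_powr) auto
  define B where "B = log_power \<beta> p ((1/2) ^ J0)"
  define C where "C = E * (2 * Z + 1) * (2 powr \<beta> * 4 powr \<bar>p\<bar>) + B"
  have "E > 0" using c3 by (simp add: E_def)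
  have "B \<ge> 0" by (simp add: B_def log_power_nonneg)
  have C: "0 < C" "B \<le> C" "E * (2 * Z + 1) * (2 powr \<beta> * 4 powr \<bar>p\<bar>) \<le> C"
  proof -
    have "0 < E * (2 * Z + 1) * (2 powr \<beta> * 4 powr \<bar>p\<bar>)"
      using \<open>E > 0\<close> \<open>Z \<ge> 0\<close> by (intro mult_pos_pos) auto
    then show "0 < C" "B \<le> C" "E * (2 * Z + 1) * (2 powr \<beta> * 4 powr \<bar>p\<bar>) \<le> C"
      using \<open>B \<ge> 0\<close> unfolding C_def by linarith+
  qed
  have half_J0: "(1/2::real) ^ J0 < 1"
    using J0[of J0] by (auto simp: power_less_one_iff)
  show thesis
  proof
    show "0 < \<gamma>'" "\<gamma>' < \<gamma>" "0 < C" using \<gamma>' C \<open>\<gamma> > 0\<close> by auto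
  next
    fix x y assume xy: "x \<in> cball x0 \<gamma>'" "y \<in> cball x0 \<gamma>'"
    have "log_power \<beta> p (\<rho> x y) \<le> B"
      unfolding B_def
    proof (rule log_power_mono)
      have "\<bar>p\<bar> / \<beta> \<le> real J0 * ln 2 - ln c3" using J0[of J0] m by simp
      moreover have "0 \<le> ln c3" using c3 by simp
      ultimately show "\<bar>p\<bar> / \<beta> \<le> - ln ((1/2) ^ J0)" by (simp only: ln_half_power)
    qed (use \<open>\<beta> > 0\<close> small[OF xy] half_J0 nonneg in auto)
    then show "\<rho> x y < 1 \<and> log_power \<beta> (\<eta> + 1/2) (\<rho> x y) \<le> C"
      using small[OF xy] half_J0 C by (simp add: p_def)
  next
    fix T :: "'b \<Rightarrow> 'c" and Q x y
    assume cont: "continuous_on K T" and "0 \<le> Q"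
      and incr: "\<And>j u v. u \<in> (D j \<union> D (Suc j)) \<inter> cball x0 \<gamma> \<Longrightarrow> v \<in> (D j \<union> D (Suc j)) \<inter> cball x0 \<gamma> \<Longrightarrow>
             \<rho> u v < 1 \<Longrightarrow> norm (T u - T v) \<le> Q * sqrt (real (Suc j)) * log_power \<beta> \<eta> (\<rho> u v)"
      and x: "x \<in> cball x0 \<gamma>' \<inter> K" and y: "y \<in> cball x0 \<gamma>' \<inter> K"
    show "norm (T x - T y) \<le> Q * C * log_power \<beta> (\<eta> + 1/2) (\<rho> x y)"
    proof (cases "x = y")
      case True
      then show ?thesis using zero_iff[of x y] by simp
    next
      case False
      then have "0 < \<rho> x y" using nonneg[of x y] zero_iff[of x y] by simp
      moreover have "\<rho> x y \<le> (1/2) ^ J0" using x y small by blast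
      ultimately obtain J where J: "J0 \<le> J" "(1/2) ^ Suc J < \<rho> x y" "\<rho> x y \<le> (1/2) ^ J"
        by (rule dyadic_scale)
      define \<pi> where "\<pi> j z = (SOME y. y \<in> D j \<and> dist z y \<le> (1/2) ^ j \<and> \<rho> z y \<le> (1/2) ^ j)" for j z
      have \<pi>: "\<pi> j z \<in> D j" "dist z (\<pi> j z) \<le> (1/2) ^ j" "\<rho> z (\<pi> j z) \<le> (1/2) ^ j"
        if "z \<in> K" for j z
        using someI_ex[OF D_net[OF that, of j, unfolded Bex_def]] by (auto simp: \<pi>_def)
      define a where "a j = ((1/2) ^ j) powr \<beta> * (real j + 1) powr p" for j
      have inball: "\<pi> j z \<in> cball x0 \<gamma>" if "z \<in> cball x0 \<gamma>' \<inter> K" "j \<ge> J0" for j z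
        using dist_triangle[of x0 "\<pi> j z" z] \<pi>(2)[of z j] that J0[OF that(2)] \<gamma>' by auto
      have step: "norm (T u - T v) \<le> Q * E * a j"
        if "u \<in> (D j \<union> D (Suc j)) \<inter> cball x0 \<gamma>" "v \<in> (D j \<union> D (Suc j)) \<inter> cball x0 \<gamma>"
          "\<rho> u v \<le> c3 * (1/2) ^ j" "j \<ge> J0" for u v j
      proof -
        note j = J0[OF \<open>j \<ge> J0\<close>] scale[OF \<open>j \<ge> J0\<close>]
        have "norm (T u - T v) \<le> Q * sqrt (real (Suc j)) * log_power \<beta> \<eta> (\<rho> u v)"
          using that j by (intro incr) auto
        also have "\<dots> \<le> Q * sqrt (real (Suc j)) * log_power \<beta> \<eta> (c3 * (1/2) ^ j)"
          using that j \<open>\<beta> > 0\<close> \<open>0 \<le> Q\<close> nonneg by (intro mult_left_mono log_power_mono) auto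
        also have "\<dots> \<le> Q * sqrt (real (Suc j)) *
            (c3 powr \<beta> * 4 powr \<bar>\<eta>\<bar> * (((1/2) ^ j) powr \<beta> * (real j + 1) powr \<eta>))"
          using j c3 \<open>0 \<le> Q\<close> by (intro mult_left_mono log_power_dyadic_le) auto
        also have "\<dots> = Q * E * (((1/2) ^ j) powr \<beta> * ((real j + 1) powr \<eta> * sqrt (real (Suc j))))"
          by (simp add: E_def mult_ac)
        also have "(real j + 1) powr \<eta> * sqrt (real (Suc j)) = (real j + 1) powr p"
          by (simp add: p_def powr_add powr_half_sqrt add.commute)
        finally show ?thesis by (simp add: a_def)
      qed
      have chain: "norm (T (\<pi> J z) - T z) \<le> Q * E * (Z * a J)" if z: "z \<in> cball x0 \<gamma>' \<inter> K" for z
      proof -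
        have link: "norm (T (\<pi> j z) - T (\<pi> (Suc j) z)) \<le> Q * E * a j" if "j \<ge> J0" for j
        proof (rule step)
          have "\<rho> (\<pi> j z) (\<pi> (Suc j) z) \<le> \<kappa> * (\<rho> (\<pi> j z) z + \<rho> z (\<pi> (Suc j) z))"
            by (rule triangle)
          also have "\<dots> \<le> \<kappa> * ((1/2) ^ j + (1/2) ^ Suc j)"
            using \<kappa> z \<pi>(3)[of z j] \<pi>(3)[of z "Suc j"] sym[of z "\<pi> j z"]
            by (intro mult_left_mono add_mono) auto
          also have "\<dots> \<le> \<kappa> * (3 * (1/2) ^ j)"
            using \<kappa> by (intro mult_left_mono) auto
          also have "\<dots> \<le> c3 * (1/2) ^ j"
            using c3 by (simp add: field_simps)
          finally show "\<rho> (\<pi> j z) (\<pi> (Suc j) z) \<le> c3 * (1/2) ^ j" .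
        qed (use z \<pi> inball that in auto)
        have partial: "norm (T (\<pi> J z) - T (\<pi> (J + n) z)) \<le> (\<Sum>i<n. Q * E * a (J + i))" for n
        proof (induction n)
          case (Suc n)
          have "norm (T (\<pi> J z) - T (\<pi> (J + Suc n) z))
              \<le> norm (T (\<pi> J z) - T (\<pi> (J + n) z)) + norm (T (\<pi> (J + n) z) - T (\<pi> (Suc (J + n)) z))"
            using norm_triangle_ineq[of "T (\<pi> J z) - T (\<pi> (J + n) z)" "T (\<pi> (J + n) z) - T (\<pi> (Suc (J + n)) z)"]
            by simp
          then show ?case using Suc link[of "J + n"] J by simp
        qed simp
        have bound: "norm (T (\<pi> J z) - T (\<pi> (J + n) z)) \<le> Q * E * (Z * a J)" for n
        proof -
          note partial[of n]
          also have "(\<Sum>i<n. Q * E * a (J + i)) = Q * E * (\<Sum>i<n. a (J + i))"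
            by (simp add: sum_distrib_left)
          also have "\<dots> \<le> Q * E * (Z * a J)"
            unfolding a_def Z_def using \<open>0 \<le> Q\<close> \<open>E > 0\<close> \<open>\<beta> > 0\<close>
            by (intro mult_left_mono sum_dyadic_tail_le) auto
          finally show ?thesis .
        qed
        have "(\<lambda>n. (1/2::real) ^ (J + n)) \<longlonglongrightarrow> 0"
          by real_asymp
        then have "(\<lambda>n. dist (\<pi> (J + n) z) z) \<longlonglongrightarrow> 0"
          by (rule Lim_null_comparison[rotated]) (use \<pi>(2)[of z] z in \<open>simp add: dist_commute\<close>)
        then have "(\<lambda>n. \<pi> (J + n) z) \<longlonglongrightarrow> z"
          by (rule tendsto_dist_iff[THEN iffD2])
        then have "(\<lambda>n. T (\<pi> (J + n) z)) \<longlonglongrightarrow> T z"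
        proof (rule continuous_on_tendsto_compose[OF cont])
          have "\<pi> (J + n) z \<in> K" for n using \<pi>(1)[of z "J + n"] z D_sub[of "J + n"] by blast
          then show "\<forall>\<^sub>F n in sequentially. \<pi> (J + n) z \<in> K" by simp
        qed (use z in simp)
        then have "(\<lambda>n. norm (T (\<pi> J z) - T (\<pi> (J + n) z))) \<longlonglongrightarrow> norm (T (\<pi> J z) - T z)"
          by (intro tendsto_intros)
        then show ?thesis
          by (rule LIMSEQ_le_const2) (use bound in blast)
      qed
      have base: "norm (T (\<pi> J x) - T (\<pi> J y)) \<le> Q * E * a J"
      proof (rule step)
        let ?h = "(1/2::real) ^ J"
        have "\<rho> (\<pi> J x) (\<pi> J y) \<le> \<kappa> * (\<rho> (\<pi> J x) x + \<rho> x (\<pi> J y))" by (rule triangle)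
        also have "\<dots> \<le> \<kappa> * (?h + \<kappa> * (\<rho> x y + \<rho> y (\<pi> J y)))"
          using \<kappa> x \<pi>(3)[of x J] sym[of x "\<pi> J x"] triangle
          by (intro mult_left_mono add_mono) auto
        also have "\<dots> \<le> \<kappa> * (\<kappa> * ?h + \<kappa> * (?h + ?h))"
          using \<kappa> y J \<pi>(3)[of y J] by (intro mult_left_mono add_mono) auto
        also have "\<dots> = c3 * ?h" by (simp add: c3_def power2_eq_square algebra_simps)
        finally show "\<rho> (\<pi> J x) (\<pi> J y) \<le> c3 * ?h" .
      qed (use x y \<pi> inball J in auto)
      have "norm (T x - T y) \<le> norm (T x - T (\<pi> J x)) + norm (T (\<pi> J x) - T (\<pi> J y)) + norm (T (\<pi> J y) - T y)"
        using norm_triangle_ineq[of "T x - T (\<pi> J x)" "T (\<pi> J x) - T y"]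
          norm_triangle_ineq[of "T (\<pi> J x) - T (\<pi> J y)" "T (\<pi> J y) - T y"] by simp
      also have "\<dots> \<le> Q * E * (Z * a J) + Q * E * a J + Q * E * (Z * a J)"
        using chain[OF x] chain[OF y] base by (intro add_mono) (auto simp: norm_minus_commute)
      also have "\<dots> = Q * (E * (2 * Z + 1) * a J)" by (simp add: algebra_simps)
      also have "\<dots> \<le> Q * (E * (2 * Z + 1) * (2 powr \<beta> * 4 powr \<bar>p\<bar> * log_power \<beta> p (\<rho> x y)))"
        unfolding a_def using J J0[of J] \<open>\<beta> > 0\<close> \<open>0 \<le> Q\<close> \<open>E > 0\<close> \<open>Z \<ge> 0\<close>
        by (intro mult_left_mono log_power_ge_dyadic) auto
      also have "\<dots> = Q * (E * (2 * Z + 1) * (2 powr \<beta> * 4 powr \<bar>p\<bar>)) * log_power \<beta> p (\<rho> x y)"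
        by (simp only: mult.assoc)
      also have "\<dots> \<le> Q * C * log_power \<beta> p (\<rho> x y)"
        using C \<open>0 \<le> Q\<close> by (intro mult_right_mono mult_left_mono log_power_nonneg) auto
      finally show ?thesis by (simp add: p_def)
    qed
  qed
qed

end

section \<open>The modulus of continuity of the remainders\<close>

lemma log_power_tendsto_0:
  assumes "\<beta> > 0"
  shows "(log_power \<beta> p \<longlongrightarrow> 0) (at_right 0)"
  unfolding log_power_def using assms by real_asymp

context quasi_metric_nets
begin

text \<open>Chaining is applied to the block sums from \<^term>\<open>N\<close> to \<^term>\<open>n\<close>, which are continuous, not to the
  remainder, about which nothing is known off the nets. As the estimate is uniform in \<^term>\<open>n\<close>, its case
  \<^term>\<open>N = 0\<close> says that the partial sums are equicontinuous, so convergence extends from the nets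
  to every point near the centre. Then \<^term>\<open>n\<close> may tend to infinity.\<close>

lemma pathwise_remainder_modulus:
  fixes W :: "nat \<Rightarrow> 'b \<Rightarrow> 'a \<Rightarrow> complex" and g :: "nat \<Rightarrow> 'a \<Rightarrow> complex" and B :: "nat \<Rightarrow> real"
  assumes cont: "\<And>n. n \<ge> 1 \<Longrightarrow> continuous_on K (\<lambda>x. W n x \<omega>)"
    and block: "\<And>N j x y n. x \<in> D j \<union> D (Suc j) \<Longrightarrow> y \<in> D j \<union> D (Suc j) \<Longrightarrow> N \<le> n \<Longrightarrow>
           ennreal ((cmod (\<Sum>l\<in>{N<..n}. (W l x \<omega> - W l y \<omega>) * g l \<omega>))\<^sup>2)
             \<le> ennreal (4 * (real (Suc k) * real (Suc j) * ln (real (N + 2))))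
                * (\<Sum>l. ennreal ((cmod (W (N + 1 + l) x \<omega> - W (N + 1 + l) y \<omega>))\<^sup>2))"
    and conv: "\<And>j x. x \<in> D j \<Longrightarrow> convergent (\<lambda>N. S_part W g N x \<omega>)"
    and pos: "\<gamma> > 0" "\<beta> > 0" "\<And>N. B N > 0"
    and r_le: "\<And>N x y. x \<in> cball x0 \<gamma> \<inter> K \<Longrightarrow> y \<in> cball x0 \<gamma> \<inter> K \<Longrightarrow> \<rho> x y < 1 \<Longrightarrow>
          r_rem W N x y \<omega> \<le> ereal (B N * log_power \<beta> \<eta> (\<rho> x y))"
  shows "\<exists>\<gamma>' C. 0 < \<gamma>' \<and> \<gamma>' < \<gamma> \<and> 0 < C \<and>
           (\<forall>N. \<forall>x \<in> cball x0 \<gamma>' \<inter> K. \<forall>y \<in> cball x0 \<gamma>' \<inter> K.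
              \<rho> x y < 1 \<and> log_power \<beta> (\<eta> + 1/2) (\<rho> x y) \<le> C \<and>
              cmod (R_rem W g N x \<omega> - R_rem W g N y \<omega>)
                \<le> C * B N * sqrt (ln (real (N + 2))) * log_power \<beta> (\<eta> + 1/2) (\<rho> x y))"
proof -
  let ?p = "\<eta> + 1/2"
  obtain r C0 where r: "0 < r" "r < \<gamma>" and "0 < C0"
    and near: "\<And>x y. x \<in> cball x0 r \<Longrightarrow> y \<in> cball x0 r \<Longrightarrow>
          \<rho> x y < 1 \<and> log_power \<beta> ?p (\<rho> x y) \<le> C0"
    and chain: "\<And>(T :: 'b \<Rightarrow> complex) Q x y.
          \<lbrakk>continuous_on K T; 0 \<le> Q;
           \<And>j u v. u \<in> (D j \<union> D (Suc j)) \<inter> cball x0 \<gamma> \<Longrightarrow> v \<in> (D j \<union> D (Suc j)) \<inter> cball x0 \<gamma> \<Longrightarrow>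
             \<rho> u v < 1 \<Longrightarrow> norm (T u - T v) \<le> Q * sqrt (real (Suc j)) * log_power \<beta> \<eta> (\<rho> u v);
           x \<in> cball x0 r \<inter> K; y \<in> cball x0 r \<inter> K\<rbrakk>
          \<Longrightarrow> norm (T x - T y) \<le> Q * C0 * log_power \<beta> ?p (\<rho> x y)"
    by (rule chaining[OF pos(2,1), where ?x0.0 = x0 and \<eta> = \<eta> and 'c = complex]) blast
  define Q where "Q N = 2 * sqrt (real (Suc k)) * sqrt (ln (real (N + 2))) * B N" for N
  have Q: "Q N \<ge> 0" for N using pos(3)[of N] by (simp add: Q_def)
  define T where "T N n x = (\<Sum>l\<in>{N<..n}. W l x \<omega> * g l \<omega>)" for N n x
  have T_S: "T N n x = S_part W g n x \<omega> - S_part W g N x \<omega>" if "N \<le> n" for N n x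
    using sum_block[OF that] by (simp add: T_def S_part_def)
  have T_bound: "cmod (T N n x - T N n y) \<le> Q N * C0 * log_power \<beta> ?p (\<rho> x y)"
    if "N \<le> n" "x \<in> cball x0 r \<inter> K" "y \<in> cball x0 r \<inter> K" for N n x y
  proof (rule chain[OF _ Q])
    show "continuous_on K (T N n)"
      unfolding T_def[abs_def] by (intro continuous_on_sum continuous_on_mult continuous_on_const cont) auto
  next
    fix j u v
    assume uv: "u \<in> (D j \<union> D (Suc j)) \<inter> cball x0 \<gamma>" "v \<in> (D j \<union> D (Suc j)) \<inter> cball x0 \<gamma>" "\<rho> u v < 1"
    let ?f = "\<lambda>l. (cmod (W (N + 1 + l) u \<omega> - W (N + 1 + l) v \<omega>))\<^sup>2"
    let ?L = "ln (real (N + 2))" and ?h = "log_power \<beta> \<eta> (\<rho> u v)"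
    have "u \<in> cball x0 \<gamma> \<inter> K" "v \<in> cball x0 \<gamma> \<inter> K"
      using uv D_sub[of j] D_sub[of "Suc j"] by auto
    from r_le[OF this \<open>\<rho> u v < 1\<close>, of N]
    have sm: "summable ?f" and s: "sqrt (suminf ?f) \<le> B N * ?h"
      by (auto simp: r_rem_def split: if_splits)
    have s0: "0 \<le> suminf ?f" by (intro suminf_nonneg sm) auto
    have diff: "T N n u - T N n v = (\<Sum>l\<in>{N<..n}. (W l u \<omega> - W l v \<omega>) * g l \<omega>)"
      by (simp add: T_def sum_subtractf left_diff_distrib)
    have "ennreal ((cmod (T N n u - T N n v))\<^sup>2)
        \<le> ennreal (4 * (real (Suc k) * real (Suc j) * ?L)) * (\<Sum>l. ennreal (?f l))"
      unfolding diff using uv \<open>N \<le> n\<close> by (intro block) auto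
    also have "(\<Sum>l. ennreal (?f l)) = ennreal (suminf ?f)"
      by (rule suminf_ennreal2[OF _ sm]) auto
    also have "ennreal (4 * (real (Suc k) * real (Suc j) * ?L)) * \<dots>
        = ennreal (4 * (real (Suc k) * real (Suc j) * ?L) * suminf ?f)"
      using s0 by (simp only: ennreal_mult'')
    finally have "(cmod (T N n u - T N n v))\<^sup>2 \<le> 4 * (real (Suc k) * real (Suc j) * ?L) * suminf ?f"
      using s0 by (subst (asm) ennreal_le_iff) (auto intro!: mult_nonneg_nonneg)
    then have "cmod (T N n u - T N n v) \<le> sqrt (4 * (real (Suc k) * real (Suc j) * ?L) * suminf ?f)"
      by (rule real_le_rsqrt)
    also have "\<dots> = 2 * sqrt (real (Suc k)) * sqrt ?L * sqrt (real (Suc j)) * sqrt (suminf ?f)"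
      by (simp only: real_sqrt_mult real_sqrt_four mult_ac)
    also have "\<dots> \<le> 2 * sqrt (real (Suc k)) * sqrt ?L * sqrt (real (Suc j)) * (B N * ?h)"
      by (intro mult_left_mono s) auto
    also have "\<dots> = Q N * sqrt (real (Suc j)) * ?h"
      by (simp only: Q_def mult_ac)
    finally show "norm (T N n u - T N n v) \<le> Q N * sqrt (real (Suc j)) * ?h" .
  qed (use that in auto)
  \<comment> \<open>Halving the radius keeps the net points near \<^term>\<open>x\<close> inside the region where the chaining estimate holds.\<close>
  have lim: "(\<lambda>n. S_part W g n x \<omega>) \<longlonglongrightarrow> S_lim W g x \<omega>" if x: "x \<in> cball x0 (r / 2) \<inter> K" for x
  proof -
    let ?S = "\<lambda>x n. S_part W g n x \<omega>"
    have "Cauchy (?S x)"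
    proof (rule metric_CauchyI)
      fix e :: real assume "e > 0"
      define d where "d = e / 3 / (Q 0 * C0 + 1)"
      have "Q 0 * C0 \<ge> 0" using Q \<open>0 < C0\<close> by simp
      then have "d > 0" "Q 0 * C0 * d < e / 3"
        using \<open>e > 0\<close> by (auto simp: d_def field_simps)
      have "\<forall>\<^sub>F h in at_right 0. log_power \<beta> ?p h < d"
        using log_power_tendsto_0[OF pos(2)] \<open>d > 0\<close> by (rule order_tendstoD)
      then obtain h0 where h0: "0 < h0" "\<And>h. 0 < h \<Longrightarrow> h < h0 \<Longrightarrow> log_power \<beta> ?p h < d"
        unfolding eventually_at_right_field by blast
      have "\<forall>\<^sub>F j in sequentially. (1/2) ^ j < h0 \<and> (1/2) ^ j < r / 2"
        using h0(1) r(1) by (intro eventually_conj; real_asymp)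
      then obtain j where j: "(1/2) ^ j < h0" "(1/2) ^ j < r / 2"
        by (auto simp: eventually_sequentially)
      obtain z where z: "z \<in> D j" "dist x z \<le> (1/2) ^ j" "\<rho> x z \<le> (1/2) ^ j"
        using D_net x by blast
      have small: "log_power \<beta> ?p (\<rho> x z) \<le> d"
        using h0(2)[of "\<rho> x z"] nonneg[of x z] z j \<open>d > 0\<close> by (cases "\<rho> x z = 0") auto
      have xz: "x \<in> cball x0 r \<inter> K" "z \<in> cball x0 r \<inter> K"
        using x z j r(1) D_sub dist_triangle[of x0 z x] by auto
      have close: "dist (?S x n) (?S z n) < e / 3" for n
      proof -
        have "cmod (T 0 n x - T 0 n z) \<le> Q 0 * C0 * log_power \<beta> ?p (\<rho> x z)"
          by (rule T_bound[OF _ xz]) simp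
        also have "\<dots> \<le> Q 0 * C0 * d" by (intro mult_left_mono small) fact
        also have "\<dots> < e / 3" by fact
        finally show ?thesis by (simp add: T_S S_part_def dist_norm)
      qed
      have "Cauchy (?S z)" using conv[OF z(1)] by (rule convergent_Cauchy)
      then obtain N where N: "dist (?S z m) (?S z n) < e / 3" if "m \<ge> N" "n \<ge> N" for m n
        using \<open>e > 0\<close> unfolding Cauchy_def by (meson zero_less_divide_iff zero_less_numeral)
      have "dist (?S x m) (?S x n) < e" if "m \<ge> N" "n \<ge> N" for m n
        using close[of m] close[of n] N[OF that]
          dist_triangle[of "?S x m" "?S x n" "?S z m"] dist_triangle[of "?S z m" "?S x n" "?S z n"]
        by (simp add: dist_commute)
      then show "\<exists>N. \<forall>m\<ge>N. \<forall>n\<ge>N. dist (?S x m) (?S x n) < e" by blast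
    qed
    then have "convergent (?S x)" by (rule Cauchy_convergent)
    then show ?thesis by (simp add: S_lim_def convergent_LIMSEQ_iff)
  qed
  have main: "cmod (R_rem W g N x \<omega> - R_rem W g N y \<omega>) \<le> Q N * C0 * log_power \<beta> ?p (\<rho> x y)"
    if x: "x \<in> cball x0 (r / 2) \<inter> K" and y: "y \<in> cball x0 (r / 2) \<inter> K" for N x y
  proof (rule LIMSEQ_le_const2)
    show "(\<lambda>n. cmod ((S_part W g n x \<omega> - S_part W g N x \<omega>) - (S_part W g n y \<omega> - S_part W g N y \<omega>)))
        \<longlonglongrightarrow> cmod (R_rem W g N x \<omega> - R_rem W g N y \<omega>)"
      unfolding R_rem_def by (intro tendsto_intros lim x y)
    have "x \<in> cball x0 r \<inter> K" "y \<in> cball x0 r \<inter> K" using x y r(1) by auto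
    then show "\<exists>n0. \<forall>n\<ge>n0. cmod ((S_part W g n x \<omega> - S_part W g N x \<omega>) - (S_part W g n y \<omega> - S_part W g N y \<omega>))
        \<le> Q N * C0 * log_power \<beta> ?p (\<rho> x y)"
      using T_bound by (auto simp flip: T_S intro!: exI[of _ N])
  qed
  define C where "C = 2 * sqrt (real (Suc k)) * C0 + C0"
  have C: "0 < C" "C0 \<le> C" "2 * sqrt (real (Suc k)) * C0 \<le> C"
    using \<open>0 < C0\<close> by (auto simp: C_def intro!: add_nonneg_pos)
  show ?thesis
  proof (rule exI[of _ "r / 2"], rule exI[of _ C], intro conjI allI ballI)
    fix N x y assume xy: "x \<in> cball x0 (r / 2) \<inter> K" "y \<in> cball x0 (r / 2) \<inter> K"
    then have "\<rho> x y < 1 \<and> log_power \<beta> ?p (\<rho> x y) \<le> C0" using r(1) by (intro near) auto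
    then show "\<rho> x y < 1" "log_power \<beta> ?p (\<rho> x y) \<le> C" using C by auto
    have "Q N * C0 = (2 * sqrt (real (Suc k)) * C0) * (B N * sqrt (ln (real (N + 2))))"
      by (simp only: Q_def mult_ac)
    also have "\<dots> \<le> C * (B N * sqrt (ln (real (N + 2))))"
      using pos(3)[of N] C by (intro mult_right_mono) auto
    finally have "Q N * C0 * log_power \<beta> ?p (\<rho> x y)
        \<le> C * (B N * sqrt (ln (real (N + 2)))) * log_power \<beta> ?p (\<rho> x y)"
      by (intro mult_right_mono log_power_nonneg)
    with main[OF xy, of N]
    show "cmod (R_rem W g N x \<omega> - R_rem W g N y \<omega>)
        \<le> C * B N * sqrt (ln (real (N + 2))) * log_power \<beta> ?p (\<rho> x y)"
      by (simp only: mult.assoc)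
  qed (use r C in auto)
qed

end

lemma log_modulus_eq_log_power:
  assumes "0 \<le> h" "h < 1"
  shows "log_modulus \<beta> p h = ereal (log_power \<beta> p h)"
  using assms by (simp add: log_modulus_def log_power_def zero_ereal_def)

theorem theorem3p3:
  fixes M :: "'w measure"
    and a b x0 :: "real ^ 'd"
    and K :: "(real ^ 'd) set"
    and g :: "nat \<Rightarrow> 'w \<Rightarrow> complex"
    and W :: "nat \<Rightarrow> real ^ 'd \<Rightarrow> 'w \<Rightarrow> complex"
    and \<rho> :: "real ^ 'd \<Rightarrow> real ^ 'd \<Rightarrow> real"
    and H1 H2 c1 c2 :: real
    and \<Omega>' :: "'w set"
    and \<gamma> \<beta> \<eta> :: "'w \<Rightarrow> real"
    and B :: "nat \<Rightarrow> 'w \<Rightarrow> real"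
  assumes "prob_space M"
    and K: "K = cbox a b" and x0: "x0 \<in> K"
    and g_indep: "prob_space.indep_vars M (\<lambda>_. borel) g {1..}"
    and g_symmetric: "\<And>n. n \<ge> 1 \<Longrightarrow> prob_space.symmetric_rv M (g n)"
    and g_sub_gaussian: "\<And>n. n \<ge> 1 \<Longrightarrow> prob_space.sub_gaussian M 1 (g n)"
    and W_field: "\<And>n. n \<ge> 1 \<Longrightarrow> prob_space.continuous_random_field M K (W n)"
    and W_summable: "\<And>x. x \<in> K \<Longrightarrow> AE \<omega> in M. summable (\<lambda>k. (cmod (W (Suc k) x \<omega>))\<^sup>2)"
    and g_W_indep: "prob_space.indep_pair M
          (\<Pi>\<^sub>M n\<in>{1..}. borel) (\<lambda>\<omega>. \<lambda>n\<in>{1..}. g n \<omega>)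
          (\<Pi>\<^sub>M p\<in>{1..} \<times> K. borel) (\<lambda>\<omega>. \<lambda>p\<in>{1..} \<times> K. W (fst p) (snd p) \<omega>)"
    and \<rho>: "quasi_metric \<rho>"
    and H: "0 < H1" "H1 \<le> H2" "H2 \<le> 1"
    and c: "0 < c1" "0 < c2"
    and \<rho>_bounds: "\<And>x y. norm (x - y) \<le> 1 \<Longrightarrow>
          c1 * norm (x - y) powr H2 \<le> \<rho> x y \<and> \<rho> x y \<le> c2 * norm (x - y) powr H1"
    and \<Omega>': "\<Omega>' \<in> sets M" "measure M \<Omega>' = 1"
    and rvs: "\<gamma> \<in> borel_measurable M" "\<beta> \<in> borel_measurable M" "\<eta> \<in> borel_measurable M"
          "\<And>N. B N \<in> borel_measurable M"
    and ranges: "\<And>\<omega>. \<omega> \<in> \<Omega>' \<Longrightarrow> 0 < \<gamma> \<omega>" "\<And>\<omega>. \<omega> \<in> \<Omega>' \<Longrightarrow> 0 < \<beta> \<omega> \<and> \<beta> \<omega> \<le> 1"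
          "\<And>\<omega> N. \<omega> \<in> \<Omega>' \<Longrightarrow> 0 < B N \<omega>"
    and r_bound: "\<And>\<omega> N x y. \<omega> \<in> \<Omega>' \<Longrightarrow> x \<in> cball x0 (\<gamma> \<omega>) \<inter> K \<Longrightarrow> y \<in> cball x0 (\<gamma> \<omega>) \<inter> K \<Longrightarrow>
          r_rem W N x y \<omega> \<le> ereal (B N \<omega>) * log_modulus (\<beta> \<omega>) (\<eta> \<omega>) (\<rho> x y)"
  shows "(AE \<omega> in M. \<exists>\<gamma>' C. 0 < \<gamma>' \<and> \<gamma>' < \<gamma> \<omega> \<and> 0 < C \<and>
            (\<forall>N. \<forall>x \<in> cball x0 \<gamma>' \<inter> K. \<forall>y \<in> cball x0 \<gamma>' \<inter> K.
               ereal (cmod (R_rem W g N x \<omega> - R_rem W g N y \<omega>))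
                 \<le> ereal (C * B N \<omega> * sqrt (ln (real (N + 2))))
                    * log_modulus (\<beta> \<omega>) (\<eta> \<omega> + 1/2) (\<rho> x y)))
       \<and> ((AE \<omega> in M. \<forall>N. cmod (R_rem W g N x0 \<omega>) \<le> B N \<omega> * sqrt (ln (real (N + 2)))) \<longrightarrow>
          (AE \<omega> in M. \<exists>\<gamma>' C. 0 < \<gamma>' \<and> \<gamma>' < \<gamma> \<omega> \<and> 0 < C \<and>
            (\<forall>N. \<forall>x \<in> cball x0 \<gamma>' \<inter> K.
               cmod (R_rem W g N x \<omega>) \<le> C * B N \<omega> * sqrt (ln (real (N + 2))))))"
proof -
  interpret prob_space M by fact
  interpret sub_gaussian_sequence M g
    by unfold_locales (use g_indep g_symmetric g_sub_gaussian in auto)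
  from \<rho> obtain \<kappa> where \<kappa>: "1 \<le> \<kappa>" "\<And>x y z. \<rho> x z \<le> \<kappa> * (\<rho> x y + \<rho> y z)"
    and \<rho>_basic: "\<And>x y. 0 \<le> \<rho> x y" "\<And>x y. \<rho> x y = 0 \<longleftrightarrow> x = y" "\<And>x y. \<rho> x y = \<rho> y x"
    unfolding quasi_metric_def by blast
  have "cbox a b \<noteq> {}" using K x0 by auto
  from quasi_metric_net[OF this \<open>0 < H1\<close> \<open>0 < c2\<close>, of \<rho>] \<rho>_bounds
  obtain D A p where D: "\<And>j. finite (D j)" "\<And>j. D j \<subseteq> K" "\<And>j. real (card (D j)) \<le> A * 2 ^ (p * j)"
    and D_net: "\<And>j x. x \<in> K \<Longrightarrow> \<exists>y\<in>D j. norm (x - y) \<le> (1/2) ^ j \<and> \<rho> x y \<le> (1/2) ^ j"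
    unfolding K by blast
  interpret quasi_metric_nets K \<rho> D \<kappa> H1 c2
  proof unfold_locales
    show "\<rho> x y = \<rho> y x" for x y by (rule \<rho>_basic(3))
  qed (use \<kappa> \<rho>_basic(1,2) D(2) D_net H c \<rho>_bounds in \<open>auto simp: dist_norm\<close>)
  let ?D = "\<lambda>j. D j \<union> D (Suc j)"
  have card_pairs: "real (card (?D j)) \<le> (A * (1 + 2 ^ p)) * 2 ^ (p * j)" for j
  proof -
    have "real (card (?D j)) \<le> real (card (D j)) + real (card (D (Suc j)))"
      using card_Un_le[of "D j" "D (Suc j)"] by linarith
    also have "\<dots> \<le> A * 2 ^ (p * j) + A * 2 ^ (p * Suc j)" by (intro add_mono D)
    also have "\<dots> = (A * (1 + 2 ^ p)) * 2 ^ (p * j)" by (simp add: power_add algebra_simps)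
    finally show ?thesis .
  qed
  have finite_pairs: "finite (?D j)" and pairs_sub: "?D j \<subseteq> K" for j using D(1,2) by auto
  note random = AE_random_weights[OF g_W_indep finite_pairs pairs_sub card_pairs]
  have "AE \<omega> in M. \<forall>n\<in>{1..}. continuous_on K (\<lambda>x. W n x \<omega>)"
    using W_field by (subst AE_ball_countable) (auto simp: continuous_random_field_def)
  moreover have "AE \<omega> in M. \<omega> \<in> \<Omega>'" using \<Omega>' by (intro AE_prob_1)
  moreover have "AE \<omega> in M. \<forall>j. \<forall>x\<in>D j. summable (\<lambda>k. (cmod (W (Suc k) x \<omega>))\<^sup>2)"
    using D W_summable by (simp add: AE_all_countable AE_finite_all subset_iff)
  ultimately have good: "AE \<omega> in M. \<omega> \<in> \<Omega>' \<and> (\<exists>\<gamma>' C. 0 < \<gamma>' \<and> \<gamma>' < \<gamma> \<omega> \<and> 0 < C \<and>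
           (\<forall>N. \<forall>x \<in> cball x0 \<gamma>' \<inter> K. \<forall>y \<in> cball x0 \<gamma>' \<inter> K.
              \<rho> x y < 1 \<and> log_power (\<beta> \<omega>) (\<eta> \<omega> + 1/2) (\<rho> x y) \<le> C \<and>
              cmod (R_rem W g N x \<omega> - R_rem W g N y \<omega>)
                \<le> C * B N \<omega> * sqrt (ln (real (N + 2))) * log_power (\<beta> \<omega>) (\<eta> \<omega> + 1/2) (\<rho> x y)))"
    using random
  proof eventually_elim
    case (elim \<omega>)
    from elim(4) obtain k where k: "\<And>N j x y n. x \<in> ?D j \<Longrightarrow> y \<in> ?D j \<Longrightarrow> N \<le> n \<Longrightarrow>
           ennreal ((cmod (\<Sum>l\<in>{N<..n}. (W l x \<omega> - W l y \<omega>) * g l \<omega>))\<^sup>2)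
             \<le> ennreal (4 * (real (Suc k) * real (Suc j) * ln (real (N + 2))))
                * (\<Sum>l. ennreal ((cmod (W (N + 1 + l) x \<omega> - W (N + 1 + l) y \<omega>))\<^sup>2))"
      by blast
    \<comment> \<open>The parameters may depend on the noise: they enter only here, for a fixed sample point.\<close>
    have "\<exists>\<gamma>' C. 0 < \<gamma>' \<and> \<gamma>' < \<gamma> \<omega> \<and> 0 < C \<and>
           (\<forall>N. \<forall>x \<in> cball x0 \<gamma>' \<inter> K. \<forall>y \<in> cball x0 \<gamma>' \<inter> K.
              \<rho> x y < 1 \<and> log_power (\<beta> \<omega>) (\<eta> \<omega> + 1/2) (\<rho> x y) \<le> C \<and>
              cmod (R_rem W g N x \<omega> - R_rem W g N y \<omega>)
                \<le> C * B N \<omega> * sqrt (ln (real (N + 2))) * log_power (\<beta> \<omega>) (\<eta> \<omega> + 1/2) (\<rho> x y))"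
    proof (rule pathwise_remainder_modulus[where B = "\<lambda>N. B N \<omega>" and k = k])
      fix N j n :: nat and x y assume "x \<in> ?D j" "y \<in> ?D j" "N \<le> n"
      then show "ennreal ((cmod (\<Sum>l\<in>{N<..n}. (W l x \<omega> - W l y \<omega>) * g l \<omega>))\<^sup>2)
             \<le> ennreal (4 * (real (Suc k) * real (Suc j) * ln (real (N + 2))))
                * (\<Sum>l. ennreal ((cmod (W (N + 1 + l) x \<omega> - W (N + 1 + l) y \<omega>))\<^sup>2))"
        by (rule k)
    next
      fix j x assume "x \<in> D j"
      then have "(\<Sum>l. ennreal ((cmod (W (Suc l) x \<omega>))\<^sup>2)) < \<infinity>"
        using elim(3) by (subst suminf_ennreal2) auto
      with elim(5) \<open>x \<in> D j\<close> show "convergent (\<lambda>N. S_part W g N x \<omega>)"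
        unfolding S_part_def by blast
    next
      fix N x y assume *: "x \<in> cball x0 (\<gamma> \<omega>) \<inter> K" "y \<in> cball x0 (\<gamma> \<omega>) \<inter> K" "\<rho> x y < 1"
      then show "r_rem W N x y \<omega> \<le> ereal (B N \<omega> * log_power (\<beta> \<omega>) (\<eta> \<omega>) (\<rho> x y))"
        using r_bound[OF elim(2) *(1,2), of N] by (simp add: log_modulus_eq_log_power \<rho>_basic)
    qed (use elim(1) ranges[OF elim(2)] in auto)
    with elim(2) show ?case by blast
  qed
  show ?thesis
  proof (intro conjI impI)
    show "AE \<omega> in M. \<exists>\<gamma>' C. 0 < \<gamma>' \<and> \<gamma>' < \<gamma> \<omega> \<and> 0 < C \<and>
            (\<forall>N. \<forall>x \<in> cball x0 \<gamma>' \<inter> K. \<forall>y \<in> cball x0 \<gamma>' \<inter> K.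
               ereal (cmod (R_rem W g N x \<omega> - R_rem W g N y \<omega>))
                 \<le> ereal (C * B N \<omega> * sqrt (ln (real (N + 2))))
                    * log_modulus (\<beta> \<omega>) (\<eta> \<omega> + 1/2) (\<rho> x y))"
      using good
    proof eventually_elim
      case (elim \<omega>)
      then obtain \<gamma>' C where \<gamma>': "0 < \<gamma>'" "\<gamma>' < \<gamma> \<omega>" "0 < C"
        and bound: "\<And>N x y. x \<in> cball x0 \<gamma>' \<inter> K \<Longrightarrow> y \<in> cball x0 \<gamma>' \<inter> K \<Longrightarrow>
              \<rho> x y < 1 \<and> cmod (R_rem W g N x \<omega> - R_rem W g N y \<omega>)
                \<le> C * B N \<omega> * sqrt (ln (real (N + 2))) * log_power (\<beta> \<omega>) (\<eta> \<omega> + 1/2) (\<rho> x y)"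
        by blast
      show ?case
        by (rule exI[of _ \<gamma>'], rule exI[of _ C], intro conjI allI ballI)
          (use \<gamma>' bound in \<open>simp_all only: log_modulus_eq_log_power \<rho>_basic times_ereal.simps ereal_less_eq\<close>)
    qed
  next
    assume "AE \<omega> in M. \<forall>N. cmod (R_rem W g N x0 \<omega>) \<le> B N \<omega> * sqrt (ln (real (N + 2)))"
    with good show "AE \<omega> in M. \<exists>\<gamma>' C. 0 < \<gamma>' \<and> \<gamma>' < \<gamma> \<omega> \<and> 0 < C \<and>
            (\<forall>N. \<forall>x \<in> cball x0 \<gamma>' \<inter> K.
               cmod (R_rem W g N x \<omega>) \<le> C * B N \<omega> * sqrt (ln (real (N + 2))))"
    proof eventually_elim
      case (elim \<omega>)
      then obtain \<gamma>' C where \<gamma>': "0 < \<gamma>'" "\<gamma>' < \<gamma> \<omega>" "0 < C"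
        and bound: "\<And>N x y. x \<in> cball x0 \<gamma>' \<inter> K \<Longrightarrow> y \<in> cball x0 \<gamma>' \<inter> K \<Longrightarrow>
              log_power (\<beta> \<omega>) (\<eta> \<omega> + 1/2) (\<rho> x y) \<le> C \<and>
              cmod (R_rem W g N x \<omega> - R_rem W g N y \<omega>)
                \<le> C * B N \<omega> * sqrt (ln (real (N + 2))) * log_power (\<beta> \<omega>) (\<eta> \<omega> + 1/2) (\<rho> x y)"
        by blast
      have "cmod (R_rem W g N x \<omega>) \<le> (1 + C * C) * B N \<omega> * sqrt (ln (real (N + 2)))"
        if x: "x \<in> cball x0 \<gamma>' \<inter> K" for N x
      proof -
        let ?b = "B N \<omega> * sqrt (ln (real (N + 2)))"
        let ?h = "log_power (\<beta> \<omega>) (\<eta> \<omega> + 1/2) (\<rho> x x0)"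
        have "0 \<le> ?b" using ranges(3)[of \<omega> N] elim by simp
        have "x0 \<in> cball x0 \<gamma>' \<inter> K" using x0 \<gamma>' by simp
        note bound_x = bound[OF x this, of N]
        have "cmod (R_rem W g N x \<omega>) \<le> cmod (R_rem W g N x0 \<omega>) + cmod (R_rem W g N x \<omega> - R_rem W g N x0 \<omega>)"
          by (metis norm_triangle_sub)
        also have "\<dots> \<le> ?b + C * ?b * ?h"
          using elim bound_x by (intro add_mono) (auto simp: mult.assoc)
        also have "\<dots> \<le> ?b + C * ?b * C"
          using bound_x \<gamma>' \<open>0 \<le> ?b\<close> by (intro add_left_mono mult_left_mono) auto
        also have "\<dots> = (1 + C * C) * B N \<omega> * sqrt (ln (real (N + 2)))" by (simp add: algebra_simps)
        finally show ?thesis .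
      qed
      moreover have "0 < 1 + C * C" using \<gamma>' by (simp add: add_pos_pos)
      ultimately show ?case using \<gamma>' by blast
    qed
  qed
qed

end
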